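(* Let $\Bbbk$ be an algebraically closed field of characteristic zero and let $R=\Bbbk[[X_1,\dots,X_n]]/I$ be a one-dimensional local domain with $n\ge 2$ and $I\subseteq (X_1,\dots,X_n)^2$. Let $x_i$ denote the image of $X_i$ in $R$, let $\mathfrak{m}=(x_1,\dots,x_n)$ be the maximal ideal of $R$, and let $\mathfrak{C}_R$ be the conductor of $R$. Identify the integral closure $\overline{R}$ of $R$ with $\Bbbk[[t]]$ and assume $x_i=\alpha_it^{a_i}$ with $\alpha_i$ units of $\Bbbk[[t]]$ and $a_1<a_2<\cdots<a_n$. Suppose that for some integer $N\geq 2$ we have $\mathfrak{m}^N\subseteq\mathfrak{C}_R$, and that the monomials $X_1^{N-1}$ and $X_1^{N-2}X_2$ do not belong to the monomial support ideal $\mathrm{Mono}(I)$ of $I$. Then the torsion submodule $\tau(\Omega_R)$ of the universally finite module of differentials $\Omega_R$ is nonzero.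
   Context: Conductor: $\mathfrak{C}_R=R:_{\mathrm{Quot}(R)}\overline{R}$, where $\overline{R}$ is the integral closure of $R$ in its fraction field. Monomial support ideal: $\mathrm{Mono}(I)$ is the smallest monomial ideal of $\Bbbk[[X_1,\dots,X_n]]$ containing $I$; it is generated by the monomials occurring with nonzero coefficient in the members of a generating set of $I$. Universally finite module of differentials: if $I=(f_1,\dots,f_m)$, then $\Omega_R$ is the cokernel of the map $R^m\to R^n$ given by the Jacobian matrix $[\partial f_j/\partial X_i]$ with entries taken in $R$; the standard basis of $R^n$ maps to $dx_1,\dots,dx_n$. $\tau(\Omega_R)$ denotes its torsion submodule (the kernel of $\Omega_R\to\Omega_R\otimes_R\mathrm{Quot}(R)$). *)

theory Defs
  imports
    "HOL-Computational_Algebra.Formal_Laurent_Series"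
    "HOL-Library.Poly_Mapping"
    "HOL-Library.Extended_Nat"
    "HOL-Algebra.Module"
    "HOL-Algebra.QuotRing"
    "HOL-Algebra.Ideal_Product"
    "HOL-Algebra.Free_Abelian_Groups"
begin

section \<open>Formal power series in several variables\<close>

text \<open>The variables are the elements of the type \<open>'n\<close>; a monomial is given by its exponent
  vector of type \<open>'n \<Rightarrow>\<^sub>0 nat\<close>.\<close>

typedef (overloaded) ('n, 'a) mfps = "UNIV :: (('n \<Rightarrow>\<^sub>0 nat) \<Rightarrow> 'a) set"
  morphisms mfps_nth Abs_mfps ..

setup_lifting type_definition_mfps

lemma mfps_eqI: "(\<And>m. mfps_nth f m = mfps_nth g m) \<Longrightarrow> f = g"
  by transfer auto

lemma finite_exponent_splits: "finite {(a, b). a + b = (m :: 'n \<Rightarrow>\<^sub>0 nat)}"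
proof -
  let ?S = "{(a, b). a + b = m}"
  let ?E = "PiE (Poly_Mapping.keys m) (\<lambda>x. {..Poly_Mapping.lookup m x})"
  let ?h = "\<lambda>ab. restrict (Poly_Mapping.lookup (fst ab)) (Poly_Mapping.keys m)"
  have zero: "Poly_Mapping.lookup a x = 0" if "a + b = m" "x \<notin> Poly_Mapping.keys m" for a b x
  proof -
    have "Poly_Mapping.lookup a x + Poly_Mapping.lookup b x = Poly_Mapping.lookup m x"
      using that(1) by (metis lookup_add)
    then show ?thesis using that(2) by (simp add: in_keys_iff)
  qed
  have "inj_on ?h ?S"
  proof (rule inj_onI, clarsimp)
    fix a b a' b'
    assume m: "m = a + b" and m': "a' + b' = a + b"
      and eq: "restrict (Poly_Mapping.lookup a) (Poly_Mapping.keys (a + b))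
             = restrict (Poly_Mapping.lookup a') (Poly_Mapping.keys (a + b))"
    have "a = a'"
    proof (rule poly_mapping_eqI)
      fix x
      show "Poly_Mapping.lookup a x = Poly_Mapping.lookup a' x"
      proof (cases "x \<in> Poly_Mapping.keys (a + b)")
        case True
        then show ?thesis using fun_cong[OF eq, of x] by simp
      next
        case False
        then show ?thesis using zero[of a b x] zero[of a' b' x] m m' by simp
      qed
    qed
    then show "a = a' \<and> b = b'" using m' by simp
  qed
  moreover have "?h ` ?S \<subseteq> ?E"
    by (auto simp: lookup_add)
  moreover have "finite ?E"
    by (intro finite_PiE) auto
  ultimately show ?thesis
    using finite_imageD finite_subset by metis
qed

instantiation mfps :: (type, comm_ring_1) comm_ring_1
begin

lift_definition zero_mfps :: "('a, 'b) mfps" is "\<lambda>_. 0" .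
lift_definition one_mfps :: "('a, 'b) mfps" is "\<lambda>m. if m = 0 then 1 else 0" .
lift_definition plus_mfps :: "('a, 'b) mfps \<Rightarrow> ('a, 'b) mfps \<Rightarrow> ('a, 'b) mfps"
  is "\<lambda>f g m. f m + g m" .
lift_definition minus_mfps :: "('a, 'b) mfps \<Rightarrow> ('a, 'b) mfps \<Rightarrow> ('a, 'b) mfps"
  is "\<lambda>f g m. f m - g m" .
lift_definition uminus_mfps :: "('a, 'b) mfps \<Rightarrow> ('a, 'b) mfps"
  is "\<lambda>f m. - f m" .
lift_definition times_mfps :: "('a, 'b) mfps \<Rightarrow> ('a, 'b) mfps \<Rightarrow> ('a, 'b) mfps"
  is "\<lambda>f g m. \<Sum>(a, b)\<in>{(a, b). a + b = m}. f a * g b" .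

instance
proof
  fix f g h :: "('a, 'b) mfps"
  show "f * g * h = f * (g * h)"
  proof (transfer, rule ext)
    fix f g h :: "('a \<Rightarrow>\<^sub>0 nat) \<Rightarrow> 'b" and m :: "'a \<Rightarrow>\<^sub>0 nat"
    have "(\<Sum>(a, b)\<in>{(a, b). a + b = m}. (\<Sum>(c, d)\<in>{(c, d). c + d = a}. f c * g d) * h b)
        = (\<Sum>(ab, cd)\<in>Sigma {(a, b). a + b = m} (\<lambda>ab. {(c, d). c + d = fst ab}).
             f (fst cd) * g (snd cd) * h (snd ab))"
      by (subst sum.Sigma[symmetric])
        (auto simp: finite_exponent_splits sum_distrib_right case_prod_beta)
    also have "\<dots> = (\<Sum>(ab, cd)\<in>Sigma {(a, b). a + b = m} (\<lambda>ab. {(c, d). c + d = snd ab}).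
             f (fst ab) * (g (fst cd) * h (snd cd)))"
      by (rule sum.reindex_bij_witness
          [where i = "\<lambda>((a, b), (c, d)). ((a + c, d), (a, c))"
             and j = "\<lambda>((a, b), (c, d)). ((c, d + b), (d, b))"])
        (auto simp: algebra_simps)
    also have "\<dots> = (\<Sum>(a, b)\<in>{(a, b). a + b = m}. f a * (\<Sum>(c, d)\<in>{(c, d). c + d = b}. g c * h d))"
      by (subst sum.Sigma[symmetric])
        (auto simp: finite_exponent_splits sum_distrib_left case_prod_beta)
    finally show "(\<Sum>(a, b)\<in>{(a, b). a + b = m}. (\<Sum>(c, d)\<in>{(c, d). c + d = a}. f c * g d) * h b)
      = (\<Sum>(a, b)\<in>{(a, b). a + b = m}. f a * (\<Sum>(c, d)\<in>{(c, d). c + d = b}. g c * h d))" .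
  qed
  show "f * g = g * f"
  proof (transfer, rule ext)
    fix f g :: "('a \<Rightarrow>\<^sub>0 nat) \<Rightarrow> 'b" and m :: "'a \<Rightarrow>\<^sub>0 nat"
    show "(\<Sum>(a, b)\<in>{(a, b). a + b = m}. f a * g b) = (\<Sum>(a, b)\<in>{(a, b). a + b = m}. g a * f b)"
      by (rule sum.reindex_bij_witness[where i = prod.swap and j = prod.swap])
        (auto simp: algebra_simps)
  qed
  show "1 * f = f"
  proof (transfer, rule ext)
    fix f :: "('a \<Rightarrow>\<^sub>0 nat) \<Rightarrow> 'b" and m :: "'a \<Rightarrow>\<^sub>0 nat"
    have "(\<Sum>(a, b)\<in>{(a, b). a + b = m}. (if a = 0 then 1 else 0) * f b)
        = (\<Sum>(a, b)\<in>{(0 :: 'a \<Rightarrow>\<^sub>0 nat, m)}. (if a = 0 then 1 else 0) * f b)"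
      by (rule sum.mono_neutral_right) (auto simp: finite_exponent_splits split: if_splits)
    then show "(\<Sum>(a, b)\<in>{(a, b). a + b = m}. (if a = 0 then 1 else 0) * f b) = f m"
      by simp
  qed
  show "(f + g) * h = f * h + g * h"
    by transfer (auto simp: algebra_simps sum.distrib case_prod_beta)
  show "(0 :: ('a, 'b) mfps) \<noteq> 1"
    by transfer (metis zero_neq_one)
qed (transfer; auto simp: algebra_simps)+

end

definition mfps_const :: "'a::zero \<Rightarrow> ('n, 'a) mfps"
  where "mfps_const c = Abs_mfps (\<lambda>m. if m = 0 then c else 0)"

definition mfps_monom :: "('n \<Rightarrow>\<^sub>0 nat) \<Rightarrow> ('n, 'a::{zero,one}) mfps"
  where "mfps_monom e = Abs_mfps (\<lambda>m. if m = e then 1 else 0)"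

definition mfps_X :: "'n \<Rightarrow> ('n, 'a::{zero,one}) mfps"
  where "mfps_X i = mfps_monom (Poly_Mapping.single i 1)"

definition mfps_deriv :: "'n \<Rightarrow> ('n, 'a::comm_ring_1) mfps \<Rightarrow> ('n, 'a) mfps"
  where "mfps_deriv i f = Abs_mfps (\<lambda>m. of_nat (Poly_Mapping.lookup m i + 1)
    * mfps_nth f (m + Poly_Mapping.single i 1))"

lemma mfps_nth_simps [simp]:
  "mfps_nth 0 m = 0"
  "mfps_nth 1 m = (if m = 0 then 1 else 0)"
  "mfps_nth (f + g) m = mfps_nth f m + mfps_nth g m"
  "mfps_nth (f - g) m = mfps_nth f m - mfps_nth g m"
  "mfps_nth (- f) m = - mfps_nth f m"
  "mfps_nth (mfps_const c) m = (if m = 0 then c else 0)"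
  "mfps_nth (mfps_monom e) m = (if m = e then 1 else 0)"
  "mfps_nth (mfps_deriv i f) m = of_nat (Poly_Mapping.lookup m i + 1)
    * mfps_nth f (m + Poly_Mapping.single i 1)"
  by (simp_all add: zero_mfps.rep_eq one_mfps.rep_eq plus_mfps.rep_eq minus_mfps.rep_eq
      uminus_mfps.rep_eq mfps_const_def mfps_monom_def mfps_deriv_def Abs_mfps_inverse)

lemma mfps_nth_mult:
  "mfps_nth (f * g) m = (\<Sum>(a, b)\<in>{(a, b). a + b = m}. mfps_nth f a * mfps_nth g b)"
  by (simp add: times_mfps.rep_eq)

lemma mfps_monom_mult:
  "mfps_monom d * mfps_monom e = (mfps_monom (d + e) :: ('n, 'a::comm_ring_1) mfps)"
proof (rule mfps_eqI)
  fix m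
  have "mfps_nth (mfps_monom d * mfps_monom e :: ('n, 'a) mfps) m
      = (\<Sum>(a, b)\<in>{(a, b). a + b = m \<and> a = d \<and> b = e}. 1)"
    unfolding mfps_nth_mult
    by (rule sum.mono_neutral_cong_right) (auto simp: finite_exponent_splits split: if_splits)
  also have "{(a, b). a + b = m \<and> a = d \<and> b = e} = (if m = d + e then {(d, e)} else {})"
    by auto
  finally show "mfps_nth (mfps_monom d * mfps_monom e :: ('n, 'a) mfps) m
      = mfps_nth (mfps_monom (d + e)) m"
    by simp
qed


section \<open>Commutative rings\<close>

definition ring_of :: "'a::comm_ring_1 set \<Rightarrow> 'a ring"
  where "ring_of S = \<lparr>carrier = S, monoid.mult = (*), one = 1, ring.zero = 0, add = (+)\<rparr>"

lemma cring_ring_of: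
  assumes "1 \<in> S" "\<And>x y. x \<in> S \<Longrightarrow> y \<in> S \<Longrightarrow> x - y \<in> S" "\<And>x y. x \<in> S \<Longrightarrow> y \<in> S \<Longrightarrow> x * y \<in> S"
  shows "cring (ring_of S)"
proof -
  have 0: "0 \<in> S" using assms(1) assms(2)[of 1 1] by simp
  have n: "- x \<in> S" if "x \<in> S" for x using assms(2)[OF 0 that] by simp
  have p: "x + y \<in> S" if "x \<in> S" "y \<in> S" for x y using assms(2)[OF that(1) n[OF that(2)]] by simp
  show ?thesis
    by (rule cringI, rule abelian_groupI, rule_tac [7] comm_monoidI)
      (auto simp: ring_of_def algebra_simps assms 0 p intro: n bexI[of _ "- x" for x])
qed

lemma cring_ring_of_UNIV: "cring (ring_of (UNIV :: 'a::comm_ring_1 set))"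
  by (rule cring_ring_of) auto

definition local_ring :: "('a, 'm) ring_scheme \<Rightarrow> bool"
  where "local_ring A \<longleftrightarrow> cring A \<and> (\<exists>!M. maximalideal M A)"

definition krull_dim :: "('a, 'm) ring_scheme \<Rightarrow> enat"
  where "krull_dim A =
    Sup {enat l | l. \<exists>p. (\<forall>i\<le>l. primeideal (p i) A) \<and> (\<forall>i<l. p i \<subset> p (Suc i))}"

definition monomial_ideal :: "('n, 'a::comm_ring_1) mfps set \<Rightarrow> bool"
  where "monomial_ideal J \<longleftrightarrow> (\<exists>E. J = genideal (ring_of UNIV) (mfps_monom ` E))"

text \<open>In finitely many variables a monomial ideal contains, with a series, every monomial that occurs
  in it; the intersection below is therefore again a monomial ideal, the smallest one
  containing \<open>I\<close>.\<close>

definition monomial_support_ideal :: "('n, 'a::comm_ring_1) mfps set \<Rightarrow> ('n, 'a) mfps set"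
  where "monomial_support_ideal I = \<Inter>{J. monomial_ideal J \<and> I \<subseteq> J}"


section \<open>Subrings of a field\<close>

text \<open>\<open>R\<close> is a subring of the ambient field; its field of fractions is formed inside that field.\<close>

definition frac_field :: "'a::field set \<Rightarrow> 'a set"
  where "frac_field R = {a / b | a b. a \<in> R \<and> b \<in> R \<and> b \<noteq> 0}"

definition integral_closure :: "'a::field set \<Rightarrow> 'a set"
  where "integral_closure R =
    {z \<in> frac_field R. \<exists>q. lead_coeff q = 1 \<and> (\<forall>i. coeff q i \<in> R) \<and> poly q z = 0}"

definition conductor :: "'a::field set \<Rightarrow> 'a set"
  where "conductor R = {z \<in> frac_field R. \<forall>y \<in> integral_closure R. z * y \<in> R}"


section \<open>Modules\<close>

text \<open>The record type of modules extends that of rings; the fields \<open>mult\<close> and \<open>one\<close> have no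
  meaning for a module.\<close>

definition free_module :: "'a::comm_ring_1 set \<Rightarrow> ('a, 'n \<Rightarrow> 'a) module"
  where "free_module R = \<lparr>carrier = {u. \<forall>i. u i \<in> R}, monoid.mult = undefined, one = undefined,
    ring.zero = (\<lambda>i. 0), add = (\<lambda>u w i. u i + w i), module.smult = (\<lambda>r u i. r * u i)\<rparr>"

definition quot_module :: "('a, 'b, 'm) module_scheme \<Rightarrow> 'b set \<Rightarrow> ('a, 'b set) module"
  where "quot_module M U = \<lparr>carrier = a_rcosets\<^bsub>M\<^esub> U, monoid.mult = undefined, one = undefined,
    ring.zero = U, add = set_add M, module.smult = (\<lambda>r C. \<Union>u\<in>C. U +>\<^bsub>M\<^esub> (r \<odot>\<^bsub>M\<^esub> u))\<rparr>"

lemma module_free_module: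
  assumes "cring (ring_of R)"
  shows "module (ring_of R) (free_module R)"
proof -
  interpret cring "ring_of R" by fact
  have 0: "0 \<in> R" using zero_closed by (simp add: ring_of_def)
  have p: "x + y \<in> R" if "x \<in> R" "y \<in> R" for x y using a_closed[of x y] that by (simp add: ring_of_def)
  have t: "x * y \<in> R" if "x \<in> R" "y \<in> R" for x y using m_closed[of x y] that by (simp add: ring_of_def)
  have n: "- x \<in> R" if "x \<in> R" for x
  proof -
    have "\<ominus>\<^bsub>ring_of R\<^esub> x \<in> R" "\<ominus>\<^bsub>ring_of R\<^esub> x + x = 0" using a_inv_closed[of x] l_neg[of x] that by (auto simp: ring_of_def)
    then show ?thesis by (metis eq_neg_iff_add_eq_0)
  qed
  have "abelian_group (free_module R)"
  proof (rule abelian_groupI)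
    fix u assume "u \<in> carrier (free_module R)"
    then show "\<exists>w\<in>carrier (free_module R). w \<oplus>\<^bsub>free_module R\<^esub> u = \<zero>\<^bsub>free_module R\<^esub>"
      by (intro bexI[of _ "\<lambda>i. - u i"]) (auto simp: free_module_def n)
  qed (auto simp: free_module_def 0 p algebra_simps)
  then show ?thesis
    by (intro moduleI assms) (auto simp: free_module_def ring_of_def t algebra_simps)
qed

lemma (in module) module_quot_module:
  assumes U: "submodule U R M"
  shows "module R (quot_module M U)"
proof -
  note Usm = submodule.smult_closed[OF U]
  interpret S: abelian_subgroup U M
    by (rule abelian_subgroupI3[OF additive_subgroup.intro[OF submodule.axioms(1)[OF U]] M.abelian_group_axioms])
  have smult: "r \<odot>\<^bsub>quot_module M U\<^esub> (U +>\<^bsub>M\<^esub> u) = U +>\<^bsub>M\<^esub> (r \<odot>\<^bsub>M\<^esub> u)"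
    if r: "r \<in> carrier R" and u: "u \<in> carrier M" for r u
  proof -
    have "U +>\<^bsub>M\<^esub> (r \<odot>\<^bsub>M\<^esub> v) = U +>\<^bsub>M\<^esub> (r \<odot>\<^bsub>M\<^esub> u)" if v: "v \<in> U +>\<^bsub>M\<^esub> u" for v
    proof -
      obtain h where h: "h \<in> U" "v = h \<oplus>\<^bsub>M\<^esub> u"
        using v by (auto simp: a_r_coset_def')
      have hM: "h \<in> carrier M" using h(1) S.a_subset by blast
      have "r \<odot>\<^bsub>M\<^esub> v = r \<odot>\<^bsub>M\<^esub> h \<oplus>\<^bsub>M\<^esub> r \<odot>\<^bsub>M\<^esub> u" using h r u hM by (simp add: smult_r_distr)
      moreover have "r \<odot>\<^bsub>M\<^esub> h \<in> U" using r h Usm by simp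
      ultimately have "r \<odot>\<^bsub>M\<^esub> v \<in> U +>\<^bsub>M\<^esub> (r \<odot>\<^bsub>M\<^esub> u)" by (auto simp: a_r_coset_def')
      then show ?thesis using S.a_repr_independence' r u smult_closed by metis
    qed
    moreover have "u \<in> U +>\<^bsub>M\<^esub> u" using S.a_rcos_self u by blast
    ultimately have "(\<Union>v\<in>U +>\<^bsub>M\<^esub> u. U +>\<^bsub>M\<^esub> (r \<odot>\<^bsub>M\<^esub> v)) = U +>\<^bsub>M\<^esub> (r \<odot>\<^bsub>M\<^esub> u)"
      by (intro SUP_eq_const) blast+
    then show ?thesis by (simp add: quot_module_def)
  qed
  have carr: "\<exists>u\<in>carrier M. C = U +>\<^bsub>M\<^esub> u" if "C \<in> carrier (quot_module M U)" for C
    using that by (auto simp: quot_module_def A_RCOSETS_def')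
  have carr2: "U +>\<^bsub>M\<^esub> u \<in> carrier (quot_module M U)" if "u \<in> carrier M" for u
    using that by (auto simp: quot_module_def A_RCOSETS_def')
  have add: "(U +>\<^bsub>M\<^esub> u) \<oplus>\<^bsub>quot_module M U\<^esub> (U +>\<^bsub>M\<^esub> w) = U +>\<^bsub>M\<^esub> (u \<oplus>\<^bsub>M\<^esub> w)"
    if "u \<in> carrier M" "w \<in> carrier M" for u w
    using S.a_rcos_sum[OF that] by (simp add: quot_module_def)
  have zero: "\<zero>\<^bsub>quot_module M U\<^esub> = U +>\<^bsub>M\<^esub> \<zero>\<^bsub>M\<^esub>"
    using S.a_subset by (simp add: quot_module_def)
  have grp: "abelian_group (quot_module M U)"
  proof (rule abelian_groupI)
    fix C assume "C \<in> carrier (quot_module M U)"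
    then obtain u where u: "u \<in> carrier M" "C = U +>\<^bsub>M\<^esub> u" using carr by blast
    show "\<exists>D\<in>carrier (quot_module M U). D \<oplus>\<^bsub>quot_module M U\<^esub> C = \<zero>\<^bsub>quot_module M U\<^esub>"
      using u by (intro bexI[of _ "U +>\<^bsub>M\<^esub> (\<ominus>\<^bsub>M\<^esub> u)"]) (simp_all add: add carr2 zero M.l_neg)
  qed ((drule carr)+, (elim bexE)?, simp add: add carr2 zero M.a_ac | simp add: zero carr2)+
  show ?thesis
  proof (rule moduleI)
    show "cring R" by (rule R.is_cring)
    show "abelian_group (quot_module M U)" by (rule grp)
  qed ((drule carr)+, elim bexE, simp add: smult add carr2 smult_l_distr smult_r_distr smult_assoc1)+
qed

definition extension_module :: "'a::comm_ring_1 set \<Rightarrow> ('a, 'a) module"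
  where "extension_module S =
    \<lparr>carrier = S, monoid.mult = (*), one = 1, ring.zero = 0, add = (+), module.smult = (*)\<rparr>"

text \<open>The tensor product is the free abelian group on the pairs modulo the subgroup generated by
  the bilinearity relations.\<close>

definition tensor_relations ::
  "('r, 'x) ring_scheme \<Rightarrow> ('r, 'b, 'y) module_scheme \<Rightarrow> ('r, 'c, 'z) module_scheme
    \<Rightarrow> ('b \<times> 'c \<Rightarrow>\<^sub>0 int) set"
  where "tensor_relations A M Q =
    {frag_of (x \<oplus>\<^bsub>M\<^esub> y, q) - frag_of (x, q) - frag_of (y, q) | x y q.
       x \<in> carrier M \<and> y \<in> carrier M \<and> q \<in> carrier Q} \<union>
    {frag_of (x, p \<oplus>\<^bsub>Q\<^esub> q) - frag_of (x, p) - frag_of (x, q) | x p q.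
       x \<in> carrier M \<and> p \<in> carrier Q \<and> q \<in> carrier Q} \<union>
    {frag_of (r \<odot>\<^bsub>M\<^esub> x, q) - frag_of (x, r \<odot>\<^bsub>Q\<^esub> q) | r x q.
       r \<in> carrier A \<and> x \<in> carrier M \<and> q \<in> carrier Q}"

definition tensor_kernel ::
  "('r, 'x) ring_scheme \<Rightarrow> ('r, 'b, 'y) module_scheme \<Rightarrow> ('r, 'c, 'z) module_scheme
    \<Rightarrow> ('b \<times> 'c \<Rightarrow>\<^sub>0 int) set"
  where "tensor_kernel A M Q =
    generate (free_Abelian_group (carrier M \<times> carrier Q)) (tensor_relations A M Q)"

definition tensor_product ::
  "('r, 'x) ring_scheme \<Rightarrow> ('r, 'b, 'y) module_scheme \<Rightarrow> ('r, 'c, 'z) module_scheme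
    \<Rightarrow> ('b \<times> 'c \<Rightarrow>\<^sub>0 int) set monoid"
  where "tensor_product A M Q =
    free_Abelian_group (carrier M \<times> carrier Q) Mod tensor_kernel A M Q"

definition pure_tensor ::
  "('r, 'x) ring_scheme \<Rightarrow> ('r, 'b, 'y) module_scheme \<Rightarrow> ('r, 'c, 'z) module_scheme
    \<Rightarrow> 'b \<Rightarrow> 'c \<Rightarrow> ('b \<times> 'c \<Rightarrow>\<^sub>0 int) set"
  where "pure_tensor A M Q x q =
    tensor_kernel A M Q #>\<^bsub>free_Abelian_group (carrier M \<times> carrier Q)\<^esub> frag_of (x, q)"

text \<open>The torsion submodule is the kernel of the map from \<open>M\<close> to the tensor product of \<open>M\<close> with the
  field of fractions, \<open>w \<mapsto> w \<otimes> 1\<close>.\<close>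

definition torsion_submodule :: "'a::field set \<Rightarrow> ('a, 'b, 'm) module_scheme \<Rightarrow> 'b set"
  where "torsion_submodule R M =
    {w \<in> carrier M. pure_tensor (ring_of R) M (extension_module (frac_field R)) w 1
       = \<one>\<^bsub>tensor_product (ring_of R) M (extension_module (frac_field R))\<^esub>}"

lemma torsion_submoduleI:
  assumes R: "cring (ring_of R)" and M: "module (ring_of R) M"
    and w: "w \<in> carrier M" and r: "r \<in> R" "r \<noteq> 0" and rw: "r \<odot>\<^bsub>M\<^esub> w = \<zero>\<^bsub>M\<^esub>"
  shows "w \<in> torsion_submodule R M"
proof -
  interpret R: cring "ring_of R" by fact
  interpret M: module "ring_of R" M by fact
  define Q where "Q = extension_module (frac_field R)"
  define G where "G = free_Abelian_group (carrier M \<times> carrier Q)"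
  define T where "T = tensor_kernel (ring_of R) M Q"
  have one: "1 \<in> R" using R.one_closed by (simp add: ring_of_def)
  have rinv: "1 / r \<in> carrier Q" and oneQ: "1 \<in> carrier Q"
    using one r unfolding Q_def extension_module_def frac_field_def
    by (auto intro: exI[of _ 1] exI[of _ r])
  have mR: "x * y \<in> R" and aR: "x + y \<in> R" if "x \<in> R" "y \<in> R" for x y
    using R.m_closed[of x y] R.a_closed[of x y] that by (simp_all add: ring_of_def)
  have rel: "tensor_relations (ring_of R) M Q \<subseteq> carrier G"
  proof -
    have Qadd: "x \<oplus>\<^bsub>Q\<^esub> y \<in> carrier Q" if "x \<in> carrier Q" "y \<in> carrier Q" for x y
    proof -
      obtain a b c d where "x = a / b" "y = c / d" "a \<in> R" "b \<in> R" "c \<in> R" "d \<in> R" "b \<noteq> 0" "d \<noteq> 0"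
        using \<open>x \<in> carrier Q\<close> \<open>y \<in> carrier Q\<close> by (auto simp: Q_def extension_module_def frac_field_def)
      moreover from this have "x + y = (a * d + c * b) / (b * d)" by (simp add: field_simps)
      moreover have "a * d + c * b \<in> R" "b * d \<in> R"
        using calculation mR aR by auto
      moreover have "b * d \<noteq> 0" using calculation by simp
      ultimately have "x + y \<in> frac_field R" unfolding frac_field_def by blast
      then show ?thesis by (simp add: Q_def extension_module_def)
    qed
    have Qsm: "s \<odot>\<^bsub>Q\<^esub> y \<in> carrier Q" if "s \<in> R" "y \<in> carrier Q" for s y
    proof -
      obtain c d where "y = c / d" "c \<in> R" "d \<in> R" "d \<noteq> 0"
        using \<open>y \<in> carrier Q\<close> by (auto simp: Q_def extension_module_def frac_field_def)
      moreover have "s * c \<in> R"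
        using calculation that mR by auto
      moreover have "s * y = s * c / d" using calculation by simp
      ultimately have "s * y \<in> frac_field R" unfolding frac_field_def by blast
      then show ?thesis by (simp add: Q_def extension_module_def)
    qed
    have d: "a - b \<in> carrier G" if "a \<in> carrier G" "b \<in> carrier G" for a b
      using that keys_diff[of a b] by (auto simp: G_def free_Abelian_group_def)
    have f: "frag_of (x, q) \<in> carrier G" if "x \<in> carrier M" "q \<in> carrier Q" for x q
      using that by (auto simp: G_def free_Abelian_group_def)
    have carr: "carrier (ring_of R) = R" by (simp add: ring_of_def)
    have Msm: "s \<odot>\<^bsub>M\<^esub> x \<in> carrier M" if "s \<in> R" "x \<in> carrier M" for s x
      using M.smult_closed[of s x] that by (simp add: carr)
    show ?thesis
      unfolding tensor_relations_def
      by (safe; intro d f; (simp add: Msm M.a_closed Qadd Qsm carr)?)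
  qed
  interpret G: group G by (simp add: G_def)
  have sub: "subgroup T G"
    unfolding T_def tensor_kernel_def G_def[symmetric] by (rule G.generate_is_subgroup[OF rel])
  have relT: "x \<in> T" if "x \<in> tensor_relations (ring_of R) M Q" for x
    unfolding T_def tensor_kernel_def using that by (rule generate.incl)
  have plus: "x + y \<in> T" if "x \<in> T" "y \<in> T" for x y
    using subgroup.m_closed[OF sub that] by (simp add: G_def free_Abelian_group_def)
  have minus: "- x \<in> T" if "x \<in> T" for x
  proof -
    have "x \<in> carrier G" using sub that by (meson subgroup.mem_carrier)
    then show ?thesis
      using subgroup.m_inv_closed[OF sub that] by (simp add: G_def)
  qed
  have "frag_of (r \<odot>\<^bsub>M\<^esub> w, 1 / r) - frag_of (w, r \<odot>\<^bsub>Q\<^esub> (1 / r)) \<in> tensor_relations (ring_of R) M Q"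
    unfolding tensor_relations_def using r(1) w rinv
    by (intro UnI2) (auto simp: ring_of_def)
  then have A: "frag_of (\<zero>\<^bsub>M\<^esub>, 1 / r) - frag_of (w, 1) \<in> T"
    using relT rw r by (simp add: Q_def extension_module_def)
  have "frag_of (\<zero>\<^bsub>M\<^esub> \<oplus>\<^bsub>M\<^esub> \<zero>\<^bsub>M\<^esub>, 1 / r) - frag_of (\<zero>\<^bsub>M\<^esub>, 1 / r) - frag_of (\<zero>\<^bsub>M\<^esub>, 1 / r)
      \<in> tensor_relations (ring_of R) M Q"
    unfolding tensor_relations_def using rinv M.zero_closed
    by (intro UnI1) blast
  then have "- frag_of (\<zero>\<^bsub>M\<^esub>, 1 / r) \<in> T"
    using relT by (metis M.r_zero M.zero_closed diff_self diff_0)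
  from minus[OF plus[OF this A]] have "frag_of (w, 1) \<in> T" by simp
  then have "T #>\<^bsub>G\<^esub> frag_of (w, 1) = T"
    using G.coset_join2[OF _ sub] subgroup.mem_carrier[OF sub] by blast
  then show ?thesis
    using w by (simp add: torsion_submodule_def pure_tensor_def tensor_product_def FactGroup_def
        T_def G_def Q_def)
qed


section \<open>The universally finite module of differentials\<close>

text \<open>Here \<open>\<phi>\<close> is the projection from the power series ring onto \<open>R\<close>, and \<open>F 1, \<dots>, F p\<close> are
  generators of its kernel; the module is the cokernel of the Jacobian map.\<close>

definition jacobian_map ::
  "(('n, 'k::comm_ring_1) mfps \<Rightarrow> 'a::comm_ring_1) \<Rightarrow> (nat \<Rightarrow> ('n, 'k) mfps) \<Rightarrow> nat
    \<Rightarrow> (nat \<Rightarrow> 'a) \<Rightarrow> 'n \<Rightarrow> 'a"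
  where "jacobian_map \<phi> F p r = (\<lambda>i. \<Sum>j = 1..p. r j * \<phi> (mfps_deriv i (F j)))"

definition differentials ::
  "'a::comm_ring_1 set \<Rightarrow> (('n, 'k::comm_ring_1) mfps \<Rightarrow> 'a) \<Rightarrow> (nat \<Rightarrow> ('n, 'k) mfps) \<Rightarrow> nat
    \<Rightarrow> ('a, ('n \<Rightarrow> 'a) set) module"
  where "differentials R \<phi> F p =
    quot_module (free_module R) (jacobian_map \<phi> F p ` ({1..p} \<rightarrow> R))"

lemma module_differentials:
  assumes R: "cring (ring_of R)" and \<phi>: "range \<phi> \<subseteq> R"
  shows "module (ring_of R) (differentials R \<phi> F p)"
proof -
  interpret R: cring "ring_of R" by fact
  interpret M: module "ring_of R" "free_module R" by (rule module_free_module[OF R])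
  have R0: "0 \<in> R" using R.zero_closed by (simp add: ring_of_def)
  have Rt: "x * y \<in> R" and Rp: "x + y \<in> R" if "x \<in> R" "y \<in> R" for x y
    using R.m_closed[of x y] R.a_closed[of x y] that by (simp_all add: ring_of_def)
  have Rn: "- x \<in> R" if "x \<in> R" for x
  proof -
    have "\<ominus>\<^bsub>ring_of R\<^esub> x \<in> R" "\<ominus>\<^bsub>ring_of R\<^esub> x + x = 0"
      using R.a_inv_closed[of x] R.l_neg[of x] that by (auto simp: ring_of_def)
    then show ?thesis by (metis eq_neg_iff_add_eq_0)
  qed
  have Rs: "sum g A \<in> R" if "\<And>j. j \<in> A \<Longrightarrow> g j \<in> R" for g and A :: "nat set"
    using that by (induction A rule: infinite_finite_induct) (auto simp: R0 Rp)
  let ?J = "jacobian_map \<phi> F p"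
  have J: "?J r \<in> carrier (free_module R)" if "r \<in> {1..p} \<rightarrow> R" for r
    using that \<phi> by (auto simp: jacobian_map_def free_module_def intro!: Rs Rt)
  have neg: "\<ominus>\<^bsub>free_module R\<^esub> u = (\<lambda>i. - u i)" if "u \<in> carrier (free_module R)" for u
    by (rule M.minus_equality) (use that Rn in \<open>auto simp: free_module_def\<close>)
  have "submodule (?J ` ({1..p} \<rightarrow> R)) (ring_of R) (free_module R)"
  proof (rule M.submoduleI)
    show "?J ` ({1..p} \<rightarrow> R) \<subseteq> carrier (free_module R)" using J by blast
    have eq: "?J (\<lambda>j. 0) = \<zero>\<^bsub>free_module R\<^esub>" by (simp add: jacobian_map_def free_module_def)
    show "\<zero>\<^bsub>free_module R\<^esub> \<in> ?J ` ({1..p} \<rightarrow> R)"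
      by (rule image_eqI[where f = ?J, OF sym[OF eq]]) (simp add: R0)
  next
    fix u assume "u \<in> ?J ` ({1..p} \<rightarrow> R)"
    then obtain r where r: "u = ?J r" "r \<in> {1..p} \<rightarrow> R" by blast
    have eq: "?J (\<lambda>j. - r j) = \<ominus>\<^bsub>free_module R\<^esub> u"
      using neg[OF J[OF r(2)]] r(1) by (simp add: jacobian_map_def sum_negf)
    have mem: "(\<lambda>j. - r j) \<in> {1..p} \<rightarrow> R" using r Rn by auto
    show "\<ominus>\<^bsub>free_module R\<^esub> u \<in> ?J ` ({1..p} \<rightarrow> R)" by (rule image_eqI[where f = ?J, OF sym[OF eq] mem])
  next
    fix u w assume "u \<in> ?J ` ({1..p} \<rightarrow> R)" "w \<in> ?J ` ({1..p} \<rightarrow> R)"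
    then obtain r s where r: "u = ?J r" "r \<in> {1..p} \<rightarrow> R" and s: "w = ?J s" "s \<in> {1..p} \<rightarrow> R"
      by blast
    have eq: "?J (\<lambda>j. r j + s j) = u \<oplus>\<^bsub>free_module R\<^esub> w"
      using r s by (simp add: jacobian_map_def free_module_def algebra_simps sum.distrib)
    have mem: "(\<lambda>j. r j + s j) \<in> {1..p} \<rightarrow> R" using r s Rp by auto
    show "u \<oplus>\<^bsub>free_module R\<^esub> w \<in> ?J ` ({1..p} \<rightarrow> R)" by (rule image_eqI[where f = ?J, OF sym[OF eq] mem])
  next
    fix c u assume c: "c \<in> carrier (ring_of R)" and "u \<in> ?J ` ({1..p} \<rightarrow> R)"
    then obtain r where r: "u = ?J r" "r \<in> {1..p} \<rightarrow> R" by blast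
    have eq: "?J (\<lambda>j. c * r j) = c \<odot>\<^bsub>free_module R\<^esub> u"
      using r by (simp add: jacobian_map_def free_module_def sum_distrib_left mult.assoc)
    have mem: "(\<lambda>j. c * r j) \<in> {1..p} \<rightarrow> R" using r c Rt by (auto simp: ring_of_def)
    show "c \<odot>\<^bsub>free_module R\<^esub> u \<in> ?J ` ({1..p} \<rightarrow> R)" by (rule image_eqI[where f = ?J, OF sym[OF eq] mem])
  qed
  then show ?thesis
    unfolding differentials_def by (rule M.module_quot_module)
qed

end

theory Submission
  imports Defs "HOL-Library.Function_Algebras"
begin

text \<open>The series \<open>z = \<integral> x\<^sub>1\<^sup>N\<^sup>-\<^sup>1 dx\<^sub>2\<close> has order at least that of \<open>x\<^sub>1\<^sup>N\<close>, which lies in the conductor,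
  so \<open>z \<in> R\<close>, and \<open>\<omega> = x\<^sub>1\<^sup>N\<^sup>-\<^sup>1 dx\<^sub>2 - dz\<close> is the required torsion element.

  It is nonzero: the image of the Jacobian map consists, modulo \<open>I\<close>, of the exact forms \<open>dG\<close> with
  \<open>G \<in> I\<close>, so \<open>\<omega> = 0\<close> would make \<open>X\<^sub>1\<^sup>N\<^sup>-\<^sup>1 dX\<^sub>2\<close> exact modulo \<open>I\<close>; this is refuted by the coefficients of
  \<open>X\<^sub>1\<^sup>N\<^sup>-\<^sup>1 dX\<^sub>2\<close> and \<open>X\<^sub>1\<^sup>N\<^sup>-\<^sup>2 X\<^sub>2 dX\<^sub>1\<close>, which no element of \<open>I\<close> can affect.

  It is torsion: otherwise some linear functional \<open>\<Lambda>\<close> over \<open>k((t))\<close> kills the rows of the Jacobian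
  matrix but not \<open>\<omega>\<close>. Then \<open>f \<mapsto> \<Lambda>(df)\<close> is a derivation of \<open>R\<close> that extends to \<open>k[[t]]\<close>. Its values have
  poles of bounded order, hence it is continuous and a multiple of \<open>d/dt\<close>, and so \<open>\<Lambda>(\<omega>) = 0\<close>.\<close>

section \<open>Partial derivatives of power series in several variables\<close>

lemma mfps_deriv_add: "mfps_deriv i (f + g) = mfps_deriv i f + mfps_deriv i g"
  by (rule mfps_eqI) (simp add: algebra_simps)

lemma mfps_deriv_sum: "mfps_deriv i (sum f A) = (\<Sum>x\<in>A. mfps_deriv i (f x))"
proof -
  have "mfps_deriv i (0 :: ('a, 'b) mfps) = 0"
    by (rule mfps_eqI) simp
  then show ?thesis
    by (induction A rule: infinite_finite_induct) (simp_all add: mfps_deriv_add)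
qed

lemma mfps_deriv_const: "mfps_deriv i (mfps_const c) = 0"
  by (rule mfps_eqI) (auto simp: plus_poly_mapping.rep_eq dest: arg_cong[where f = "\<lambda>m. Poly_Mapping.lookup m i"])

text \<open>In a convolution term with \<open>a + b = m + ?e\<close> the factor contributed by
  differentiation splits as the \<open>i\<close>-exponent of \<open>a\<close> plus that of
  \<open>b\<close>. Each summand yields one Leibniz term, the second by symmetry from the
  first.\<close>

lemma mfps_deriv_mult:
  "mfps_deriv i (f * g) = f * mfps_deriv i g + g * mfps_deriv i f"
proof (rule mfps_eqI)
  fix m
  let ?e = "Poly_Mapping.single i (1 :: nat)"
  have deriv_right: "(\<Sum>(a, b)\<in>{(a, b). a + b = m + ?e}.
        of_nat (Poly_Mapping.lookup b i) * (mfps_nth f a * mfps_nth g b))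
      = mfps_nth (f * mfps_deriv i g) m" for f g :: "('a, 'b) mfps"
  proof -
    have shift: "b - ?e + ?e = b" if "Poly_Mapping.lookup b i \<noteq> 0" for b
      using that by (intro poly_mapping_eqI)
        (auto simp: lookup_add lookup_minus lookup_single when_def)
    \<comment> \<open>Subtraction of exponents is truncated, so the terms in which \<open>b\<close>
      has \<open>i\<close>-exponent 0, whose weight is 0, are dropped before \<open>b\<close> is
      replaced by \<open>b - ?e\<close>.\<close>
    have "(\<Sum>(a, b)\<in>{(a, b). a + b = m + ?e}.
        of_nat (Poly_Mapping.lookup b i) * (mfps_nth f a * mfps_nth g b))
      = (\<Sum>(a, b)\<in>{(a, b). a + b = m + ?e \<and> Poly_Mapping.lookup b i \<noteq> 0}.
        of_nat (Poly_Mapping.lookup b i) * (mfps_nth f a * mfps_nth g b))"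
      by (rule sum.mono_neutral_right)
        (auto intro: finite_subset[OF _ finite_exponent_splits[of "m + ?e"]] intro!: gr0I)
    also have "\<dots> = (\<Sum>(a, b)\<in>{(a, b). a + b = m}.
        of_nat (Poly_Mapping.lookup b i + 1) * (mfps_nth f a * mfps_nth g (b + ?e)))"
    proof (rule sum.reindex_bij_witness
        [where i = "\<lambda>(a, b). (a, b + ?e)" and j = "\<lambda>(a, b). (a, b - ?e)"], goal_cases)
      case (2 x)
      obtain a b where x: "x = (a, b)" by force
      with 2 have "a + (b - ?e + ?e) = m + ?e" using shift by auto
      then have "a + (b - ?e) + ?e = m + ?e" by (simp add: add.assoc)
      then show ?case using x by simp
    next
      case (5 x)
      then show ?case using shift
        by (auto simp: lookup_minus)
    qed (auto simp: lookup_add shift[simplified] add.assoc[symmetric])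
    also have "\<dots> = mfps_nth (f * mfps_deriv i g) m"
      unfolding mfps_nth_mult by (rule sum.cong) (auto simp: algebra_simps)
    finally show ?thesis .
  qed
  have "mfps_nth (mfps_deriv i (f * g)) m = (\<Sum>(a, b)\<in>{(a, b). a + b = m + ?e}.
      of_nat (Poly_Mapping.lookup (m + ?e) i) * (mfps_nth f a * mfps_nth g b))"
    by (simp add: lookup_add mfps_nth_mult sum_distrib_left case_prod_beta)
  also have "\<dots> = (\<Sum>(a, b)\<in>{(a, b). a + b = m + ?e}.
      of_nat (Poly_Mapping.lookup b i) * (mfps_nth f a * mfps_nth g b)
      + of_nat (Poly_Mapping.lookup a i) * (mfps_nth f a * mfps_nth g b))"
  proof (rule sum.cong, rule refl, clarify)
    fix a b assume "a + b = m + ?e"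
    then have "Poly_Mapping.lookup (m + ?e) i = Poly_Mapping.lookup a i + Poly_Mapping.lookup b i"
      by (metis lookup_add)
    then show "of_nat (Poly_Mapping.lookup (m + ?e) i) * (mfps_nth f a * mfps_nth g b)
      = of_nat (Poly_Mapping.lookup b i) * (mfps_nth f a * mfps_nth g b)
      + of_nat (Poly_Mapping.lookup a i) * (mfps_nth f a * mfps_nth g b)"
      by (simp add: algebra_simps)
  qed
  also have "\<dots> = mfps_nth (f * mfps_deriv i g) m
      + (\<Sum>(a, b)\<in>{(a, b). a + b = m + ?e}.
          of_nat (Poly_Mapping.lookup a i) * (mfps_nth f a * mfps_nth g b))"
    by (simp add: case_prod_beta sum.distrib deriv_right[symmetric])
  also have "(\<Sum>(a, b)\<in>{(a, b). a + b = m + ?e}.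
          of_nat (Poly_Mapping.lookup a i) * (mfps_nth f a * mfps_nth g b))
      = (\<Sum>(a, b)\<in>{(a, b). a + b = m + ?e}.
          of_nat (Poly_Mapping.lookup b i) * (mfps_nth g a * mfps_nth f b))"
    by (rule sum.reindex_bij_witness[where i = prod.swap and j = prod.swap])
      (auto simp: algebra_simps)
  finally show "mfps_nth (mfps_deriv i (f * g)) m
      = mfps_nth (f * mfps_deriv i g + g * mfps_deriv i f) m"
    by (simp only: deriv_right mfps_nth_simps)
qed

lemma mfps_deriv_X: "mfps_deriv i (mfps_X k) = (if i = k then 1 else 0)"
proof (rule mfps_eqI)
  fix m
  show "mfps_nth (mfps_deriv i (mfps_X k)) m = mfps_nth (if i = k then 1 else 0) m"
  proof (cases "m + Poly_Mapping.single i 1 = Poly_Mapping.single k 1")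
    case True
    then have "Poly_Mapping.lookup m l + Poly_Mapping.lookup (Poly_Mapping.single i (1 :: nat)) l
        = Poly_Mapping.lookup (Poly_Mapping.single k 1) l" for l
      by (metis lookup_add)
    from this[of i] have "i = k" by (simp add: lookup_single when_def split: if_splits)
    with True show ?thesis by (simp add: mfps_X_def)
  next
    case False
    then show ?thesis by (auto simp: mfps_X_def)
  qed
qed

lemma mfps_X_power: "mfps_X i ^ k = (mfps_monom (Poly_Mapping.single i k) :: ('n, 'a::comm_ring_1) mfps)"
proof (induction k)
  case 0
  show ?case by (rule mfps_eqI) simp
next
  case (Suc k)
  then show ?case
    by (simp add: mfps_X_def mfps_monom_mult single_add[symmetric])
qed

section \<open>Generated ideals and monomial support\<close>

lemma ring_of_simps [simp]:
  "carrier (ring_of S) = S" "x \<otimes>\<^bsub>ring_of S\<^esub> y = x * y" "x \<oplus>\<^bsub>ring_of S\<^esub> y = x + y"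
  "\<one>\<^bsub>ring_of S\<^esub> = 1" "\<zero>\<^bsub>ring_of S\<^esub> = 0"
  by (simp_all add: ring_of_def)

lemma ideal_ring_of_UNIV_I:
  assumes "0 \<in> J" "\<And>f g. f \<in> J \<Longrightarrow> g \<in> J \<Longrightarrow> f + g \<in> J" "\<And>f g. g \<in> J \<Longrightarrow> f * g \<in> J"
  shows "ideal J (ring_of (UNIV :: 'a::comm_ring_1 set))"
proof -
  interpret cring "ring_of (UNIV :: 'a set)" by (rule cring_ring_of_UNIV)
  show ?thesis
  proof (rule idealI)
    show "ring (ring_of (UNIV :: 'a set))" by (rule ring_axioms)
    show "subgroup J (add_monoid (ring_of (UNIV :: 'a set)))"
    proof (rule add.subgroupI)
      fix f assume "f \<in> J"
      moreover have "\<ominus>\<^bsub>ring_of UNIV\<^esub> f = - 1 * f"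
        by (rule minus_equality) auto
      ultimately show "\<ominus>\<^bsub>ring_of UNIV\<^esub> f \<in> J" using assms(3)[of f "- 1"] by simp
    qed (use assms in auto)
  qed (use assms in \<open>auto simp: mult.commute\<close>)
qed

text \<open>The coefficients are indexed by \<open>A\<close> and not by the image, so repeated
  generators are harmless and the sums match those in \<open>jacobian_map\<close>.\<close>

lemma genideal_image_ring_of_UNIV:
  fixes F :: "'i \<Rightarrow> 'a::comm_ring_1"
  assumes "finite A"
  shows "genideal (ring_of UNIV) (F ` A) = {\<Sum>j\<in>A. r j * F j | r. True}"
proof
  have "ideal {\<Sum>j\<in>A. r j * F j | r. True} (ring_of UNIV)"
  proof (rule ideal_ring_of_UNIV_I)
    show "0 \<in> {\<Sum>j\<in>A. r j * F j | r. True}"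
      by (auto intro!: exI[of _ "\<lambda>_. 0"])
  next
    fix f g assume "f \<in> {\<Sum>j\<in>A. r j * F j | r. True}" "g \<in> {\<Sum>j\<in>A. r j * F j | r. True}"
    then obtain r s where "f = (\<Sum>j\<in>A. r j * F j)" "g = (\<Sum>j\<in>A. s j * F j)" by blast
    then show "f + g \<in> {\<Sum>j\<in>A. r j * F j | r. True}"
      by (auto intro!: exI[of _ "\<lambda>j. r j + s j"] simp: algebra_simps sum.distrib)
  next
    fix f g assume "g \<in> {\<Sum>j\<in>A. r j * F j | r. True}"
    then obtain r where "g = (\<Sum>j\<in>A. r j * F j)" by blast
    then show "f * g \<in> {\<Sum>j\<in>A. r j * F j | r. True}"
      by (auto intro!: exI[of _ "\<lambda>j. f * r j"] simp: mult.assoc sum_distrib_left)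
  qed
  moreover have "F ` A \<subseteq> {\<Sum>j\<in>A. r j * F j | r. True}"
  proof (clarify)
    fix j assume "j \<in> A"
    then show "\<exists>r. F j = (\<Sum>j\<in>A. r j * F j) \<and> True"
      using assms by (intro exI[of _ "\<lambda>l. if l = j then 1 else 0"]) (simp add: mult_delta_left)
  qed
  ultimately show "genideal (ring_of UNIV) (F ` A) \<subseteq> {\<Sum>j\<in>A. r j * F j | r. True}"
    unfolding genideal_def by blast
  show "{\<Sum>j\<in>A. r j * F j | r. True} \<subseteq> genideal (ring_of UNIV) (F ` A)"
  proof -
    interpret cring "ring_of (UNIV :: 'a set)" by (rule cring_ring_of_UNIV)
    interpret J: ideal "genideal (ring_of UNIV) (F ` A)" "ring_of UNIV"
      by (rule genideal_ideal) simp
    have mem: "F j \<in> genideal (ring_of UNIV) (F ` A)" if "j \<in> A" for j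
      using genideal_self[of "F ` A"] that by auto
    have "(\<Sum>j\<in>B. r j * F j) \<in> genideal (ring_of UNIV) (F ` A)" if "B \<subseteq> A" for r B
      using finite_subset[OF that assms] that
    proof (induction B rule: finite_induct)
      case empty
      show ?case using J.zero_closed by simp
    next
      case (insert b B)
      then show ?case using J.a_closed J.I_l_closed[OF mem[of b], of "r b"] by simp
    qed
    then show ?thesis by blast
  qed
qed

text \<open>Let \<open>J\<close> be a monomial ideal containing \<open>I\<close>, generated by the
  monomials with exponents in \<open>E\<close>. The series all of whose occurring monomials are
  divisible by one of these form an ideal containing \<open>J\<close>, so the monomial of
  \<open>m\<close> is a multiple of a generator of \<open>J\<close>.\<close>

lemma monomial_in_monomial_support_ideal:
  fixes f :: "('n, 'a::comm_ring_1) mfps"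
  assumes "f \<in> I" "mfps_nth f m \<noteq> 0"
  shows "mfps_monom m \<in> monomial_support_ideal I"
  unfolding monomial_support_ideal_def
proof (clarify)
  fix J :: "('n, 'a) mfps set"
  assume "monomial_ideal J" "I \<subseteq> J"
  then obtain E where J: "J = genideal (ring_of UNIV) (mfps_monom ` E)"
    by (auto simp: monomial_ideal_def)
  define S where "S = {g :: ('n, 'a) mfps. \<forall>m. mfps_nth g m \<noteq> 0 \<longrightarrow> (\<exists>e\<in>E. \<exists>d. m = d + e)}"
  have "ideal S (ring_of UNIV)"
  proof (rule ideal_ring_of_UNIV_I)
    fix g h assume "g \<in> S" "h \<in> S"
    then show "g + h \<in> S" unfolding S_def by (force simp del: ex_simps)
  next
    fix g h :: "('n, 'a) mfps" assume h: "h \<in> S"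
    show "g * h \<in> S"
      unfolding S_def
    proof (clarify)
      fix m assume "mfps_nth (g * h) m \<noteq> 0"
      moreover have "mfps_nth (g * h) m = 0" if "\<And>a b. a + b = m \<Longrightarrow> mfps_nth h b = 0"
        unfolding mfps_nth_mult by (rule sum.neutral) (auto simp: that)
      ultimately obtain a b where ab: "a + b = m" "mfps_nth h b \<noteq> 0" by blast
      then obtain e d where "e \<in> E" "b = d + e" using h unfolding S_def by blast
      with ab(1) show "\<exists>e\<in>E. \<exists>d. m = d + e"
        by (intro bexI[of _ e] exI[of _ "a + d"]) (auto simp: add.assoc)
    qed
  qed (simp add: S_def)
  moreover have "mfps_monom ` E \<subseteq> S"
    by (auto simp: S_def split: if_splits intro!: exI[of _ 0])
  ultimately have "J \<subseteq> S" unfolding J genideal_def by blast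
  then have "f \<in> S" using assms(1) \<open>I \<subseteq> J\<close> by blast
  then obtain e d where e: "e \<in> E" "m = d + e" using assms(2) unfolding S_def by blast
  interpret cring "ring_of (UNIV :: ('n, 'a) mfps set)" by (rule cring_ring_of_UNIV)
  interpret J: ideal J "ring_of UNIV"
    unfolding J by (rule genideal_ideal) simp
  have "mfps_monom e \<in> J" using genideal_self[of "mfps_monom ` E"] e(1) unfolding J by auto
  from J.I_l_closed[OF this, of "mfps_monom d"] show "mfps_monom m \<in> J"
    by (simp add: mfps_monom_mult e(2))
qed

text \<open>The two memberships would force the coefficient of \<open>X\<^sub>u\<^sup>N\<^sup>-\<^sup>1 X\<^sub>w\<close> in \<open>h\<close> to be
  both \<open>1\<close> and \<open>0\<close>.\<close>

lemma power_dX_not_exact_mod_ideal: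
  fixes I :: "('n, 'k::{idom, ring_char_0}) mfps set"
  assumes "u \<noteq> w" "N \<ge> 2"
    and "mfps_X u ^ (N - 1) \<notin> monomial_support_ideal I"
    and "mfps_X u ^ (N - 2) * mfps_X w \<notin> monomial_support_ideal I"
    and w: "mfps_X u ^ (N - 1) - mfps_deriv w h \<in> I"
  shows "- mfps_deriv u h \<notin> I"
proof
  assume u: "- mfps_deriv u h \<in> I"
  let ?m = "Poly_Mapping.single u (N - 1)"
  let ?l = "Poly_Mapping.single u (N - 2) + Poly_Mapping.single w 1"
  have "mfps_nth (mfps_X u ^ (N - 1) - mfps_deriv w h) ?m = 0"
    using monomial_in_monomial_support_ideal[OF w] assms(3) by (metis mfps_X_power)
  then have "mfps_nth h (?m + Poly_Mapping.single w 1) = 1"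
    using assms(1) by (simp add: mfps_X_power lookup_single)
  moreover have "mfps_nth (- mfps_deriv u h) ?l = 0"
  proof -
    have "mfps_X u ^ (N - 2) * mfps_X w = (mfps_monom ?l :: ('n, 'k) mfps)"
      unfolding mfps_X_power by (simp add: mfps_X_def mfps_monom_mult)
    then show ?thesis
      using monomial_in_monomial_support_ideal[OF u] assms(4) by metis
  qed
  \<comment> \<open>Both derivatives read the same coefficient of \<open>h\<close>, the one with
    exponent \<open>N - 1\<close> at \<open>u\<close> and 1 at \<open>w\<close>.\<close>
  moreover have "?l + Poly_Mapping.single u 1 = ?m + Poly_Mapping.single w 1"
  proof -
    have "Poly_Mapping.single u (N - 2) + Poly_Mapping.single u 1 = ?m"
      using assms(2) by (simp add: single_add[symmetric] Suc_diff_Suc numeral_2_eq_2)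
    then show ?thesis by (metis add.assoc add.commute)
  qed
  \<comment> \<open>That coefficient is 1, and the derivative in \<open>u\<close> multiplies it by
    \<open>N - 1\<close>, which is nonzero in characteristic zero.\<close>
  ultimately have "of_nat (Poly_Mapping.lookup ?l u + 1) = (0 :: 'k)"
    by (simp del: of_nat_add of_nat_Suc)
  then show False by (metis of_nat_eq_0_iff add_is_0 zero_neq_one)
qed

section \<open>Bounded poles and derivations of k[[t]]\<close>

lemma finite_fls_common_denominator:
  assumes "finite (A :: 'k::idom fls set)"
  shows "\<exists>B. \<forall>c\<in>A. fls_X ^ B * c \<in> range fps_to_fls"
  using assms
proof (induction A rule: finite_induct)
  case (insert c A)
  then obtain B where B: "\<And>c. c \<in> A \<Longrightarrow> fls_X ^ B * c \<in> range fps_to_fls" by blast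
  have "\<exists>m. fls_X ^ m * c \<in> range fps_to_fls"
  proof (intro exI)
    \<comment> \<open>The pole order of \<open>c\<close>; \<open>nat\<close> makes it 0 when there
      is no pole.\<close>
    let ?m = "nat (- fls_subdegree c)"
    have "fls_X ^ ?m * c = fps_to_fls (fls_regpart (fls_X ^ ?m * c))"
    proof (rule fls_eqI)
      fix k
      show "fls_nth (fls_X ^ ?m * c) k = fls_nth (fps_to_fls (fls_regpart (fls_X ^ ?m * c))) k"
        by (auto simp: fls_X_power_times_conv_shift intro!: fls_eq0_below_subdegree)
    qed
    then show "fls_X ^ ?m * c \<in> range fps_to_fls" by blast
  qed
  then obtain m where m: "fls_X ^ m * c \<in> range fps_to_fls" by blast
  have X: "fls_X ^ k * d \<in> range fps_to_fls" if d: "d \<in> range fps_to_fls" for k and d :: "'k fls"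
  proof -
    obtain e where "d = fps_to_fls e" using d by blast
    then have "fls_X ^ k * d = fps_to_fls (fps_X ^ k * e)"
      by (simp add: fls_times_fps_to_fls fps_to_fls_power)
    then show ?thesis by blast
  qed
  have "fls_X ^ (B + m) * d \<in> range fps_to_fls" if "d \<in> insert c A" for d
    using that
  proof
    assume "d = c"
    then show ?thesis using X[OF m, of B] by (simp add: power_add mult.assoc)
  next
    assume "d \<in> A"
    then show ?thesis using X[OF B, of d m] by (simp add: power_add mult_ac)
  qed
  then show ?case by blast
qed simp

text \<open>The difference \<open>\<epsilon>\<close> of both sides kills constants and t. Splitting
  off constant terms repeatedly makes each of its values divisible by every power of t, with a
  cofactor whose pole has order at most \<open>B\<close>; only 0 remains. The bound takes the place
  of continuity.\<close>

lemma fps_derivation_eq: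
  fixes \<delta> :: "'k::idom fps \<Rightarrow> 'k fls"
  assumes add: "\<And>u w. \<delta> (u + w) = \<delta> u + \<delta> w"
    and mult: "\<And>u w. \<delta> (u * w) = fps_to_fls u * \<delta> w + fps_to_fls w * \<delta> u"
    and const: "\<And>c. \<delta> (fps_const c) = 0"
    and bounded: "\<And>w. fls_X ^ B * \<delta> w \<in> range fps_to_fls"
  shows "\<delta> w = \<delta> fps_X * fps_to_fls (fps_deriv w)"
proof -
  define \<epsilon> where "\<epsilon> w = \<delta> w - \<delta> fps_X * fps_to_fls (fps_deriv w)" for w
  have shift: "\<epsilon> w = fls_X * \<epsilon> (fps_shift 1 w)" for w
  proof -
    have w: "w = fps_const (fps_nth w 0) + fps_X * fps_shift 1 w"
      by (rule fps_ext) (simp add: fps_X_mult_nth)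
    have "\<delta> w = fls_X * \<delta> (fps_shift 1 w) + fps_to_fls (fps_shift 1 w) * \<delta> fps_X"
      by (subst w) (simp add: add mult const)
    moreover have "fps_deriv w = fps_shift 1 w + fps_X * fps_deriv (fps_shift 1 w)"
    proof (rule fps_ext)
      fix k
      show "fps_nth (fps_deriv w) k = fps_nth (fps_shift 1 w + fps_X * fps_deriv (fps_shift 1 w)) k"
        by (cases k) (simp_all add: algebra_simps)
    qed
    ultimately show ?thesis
      by (simp add: \<epsilon>_def fls_times_fps_to_fls algebra_simps)
  qed
  have divisible: "\<exists>u. \<epsilon> w = fls_X ^ s * \<epsilon> u" for s
  proof (induction s)
    case 0
    show ?case by (intro exI[of _ w]) simp
  next
    case (Suc s)
    then obtain u where "\<epsilon> w = fls_X ^ s * \<epsilon> u" by blast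
    with shift[of u] show ?case by (intro exI[of _ "fps_shift 1 u"]) (simp add: mult_ac)
  qed
  have integral: "fls_X ^ B * \<epsilon> u \<in> range fps_to_fls" for u
  proof -
    obtain d e where "fls_X ^ B * \<delta> u = fps_to_fls d" "fls_X ^ B * \<delta> fps_X = fps_to_fls e"
      using bounded[of u] bounded[of fps_X] by blast
    then have "fls_X ^ B * \<epsilon> u = fps_to_fls (d - e * fps_deriv u)"
      by (simp add: \<epsilon>_def algebra_simps fls_times_fps_to_fls)
    then show ?thesis by blast
  qed
  have "fls_X ^ B * \<epsilon> w = 0"
  proof (rule fls_eqI)
    fix k
    \<comment> \<open>Multiplied by a power series, this power of t starts beyond position
      \<open>k\<close>, also for negative \<open>k\<close>, where \<open>nat k\<close> is 0.\<close>
    let ?s = "nat k + 1"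
    obtain u d where "\<epsilon> w = fls_X ^ ?s * \<epsilon> u" "fls_X ^ B * \<epsilon> u = fps_to_fls d"
      using divisible integral by blast
    then have "fls_X ^ B * \<epsilon> w = fls_X ^ ?s * fps_to_fls d" by (simp add: mult_ac)
    then show "fls_nth (fls_X ^ B * \<epsilon> w) k = fls_nth 0 k"
      by (simp only: fls_X_power_times_conv_shift fls_shift_nth fps_to_fls_nth) simp
  qed
  then show ?thesis by (simp add: \<epsilon>_def)
qed

text \<open>Since \<open>x\<close> multiplies \<open>k[[t]]\<close> into \<open>R\<close>, the derivation extends to \<open>k[[t]]\<close> by
  \<open>w \<mapsto> (\<delta> (x w) - w \<delta> x) / x\<close>.\<close>

lemma subring_derivation_eq:
  fixes R :: "'k::field fls set"
  assumes R_mult: "\<And>r s. r \<in> R \<Longrightarrow> s \<in> R \<Longrightarrow> r * s \<in> R"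
    and R_const: "\<And>c. fls_const c \<in> R"
    and x: "x \<noteq> 0" "x \<in> R" "\<And>w. x * fps_to_fls w \<in> R"
    and add: "\<And>r s. r \<in> R \<Longrightarrow> s \<in> R \<Longrightarrow> \<delta> (r + s) = \<delta> r + \<delta> s"
    and mult: "\<And>r s. r \<in> R \<Longrightarrow> s \<in> R \<Longrightarrow> \<delta> (r * s) = r * \<delta> s + s * \<delta> r"
    and const: "\<And>c. \<delta> (fls_const c) = 0"
    and bounded: "\<And>r. r \<in> R \<Longrightarrow> fls_X ^ B * \<delta> r \<in> range fps_to_fls"
  shows "\<exists>c. \<forall>w. fps_to_fls w \<in> R \<longrightarrow> \<delta> (fps_to_fls w) = c * fps_to_fls (fps_deriv w)"
proof -
  define \<Delta> where "\<Delta> w = (\<delta> (x * fps_to_fls w) - fps_to_fls w * \<delta> x) / x" for w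
  have x\<Delta>: "\<delta> (x * fps_to_fls w) = x * \<Delta> w + fps_to_fls w * \<delta> x" for w
    using x(1) by (simp add: \<Delta>_def)
  have ext: "\<Delta> w = \<delta> (fps_to_fls w)" if "fps_to_fls w \<in> R" for w
    using mult[OF x(2) that] x(1) by (simp add: \<Delta>_def)
  obtain B' where B': "fls_X ^ B' * inverse x \<in> range fps_to_fls"
    using finite_fls_common_denominator[of "{inverse x}"] by blast
  \<comment> \<open>\<open>B'\<close> absorbs the pole introduced by the division by
    \<open>x\<close> in \<open>\<Delta>\<close>.\<close>
  have "\<Delta> w = \<Delta> fps_X * fps_to_fls (fps_deriv w)" for w
  proof (rule fps_derivation_eq[where B = "B + B'"])
    fix u w
    show "\<Delta> (u + w) = \<Delta> u + \<Delta> w"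
      using x(1) add[OF x(3)[of u] x(3)[of w]] by (simp add: \<Delta>_def field_simps)
    \<comment> \<open>Since \<open>u\<close> and \<open>w\<close> may lie outside \<open>R\<close>,
      the Leibniz rule is applied to two factorizations of x^2 u w whose factors x, x u w and x u, x
      w all lie in \<open>R\<close>.\<close>
    have "x * \<delta> (x * fps_to_fls (u * w)) + x * fps_to_fls (u * w) * \<delta> x
        = \<delta> (x * (x * fps_to_fls (u * w)))"
      by (rule mult[OF x(2) x(3), symmetric])
    also have "\<dots> = \<delta> ((x * fps_to_fls u) * (x * fps_to_fls w))"
      by (simp add: fls_times_fps_to_fls mult_ac)
    also have "\<dots> = x * fps_to_fls u * \<delta> (x * fps_to_fls w) + x * fps_to_fls w * \<delta> (x * fps_to_fls u)"
      by (rule mult[OF x(3) x(3)])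
    finally have "x * x * \<Delta> (u * w) = x * x * (fps_to_fls u * \<Delta> w + fps_to_fls w * \<Delta> u)"
      by (simp only: x\<Delta>) (simp add: fls_times_fps_to_fls algebra_simps)
    then show "\<Delta> (u * w) = fps_to_fls u * \<Delta> w + fps_to_fls w * \<Delta> u"
      using x(1) by simp
  next
    fix c show "\<Delta> (fps_const c) = 0"
      using ext[of "fps_const c"] R_const[of c] const[of c] by simp
  next
    fix w
    obtain d e f where "fls_X ^ B * \<delta> (x * fps_to_fls w) = fps_to_fls d"
        "fls_X ^ B * \<delta> x = fps_to_fls e" "fls_X ^ B' * inverse x = fps_to_fls f"
      using bounded[OF x(3)[of w]] bounded[OF x(2)] B' by blast
    moreover have "fls_X ^ (B + B') * \<Delta> w
      = (fls_X ^ B * \<delta> (x * fps_to_fls w) - fps_to_fls w * (fls_X ^ B * \<delta> x)) * (fls_X ^ B' * inverse x)"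
      by (simp add: \<Delta>_def divide_inverse power_add algebra_simps)
    ultimately have "fls_X ^ (B + B') * \<Delta> w = fps_to_fls ((d - w * e) * f)"
      by (simp add: fls_times_fps_to_fls)
    then show "fls_X ^ (B + B') * \<Delta> w \<in> range fps_to_fls" by blast
  qed
  with ext show ?thesis by metis
qed

section \<open>Linear algebra over a field\<close>

lemma separating_linear_functional:
  fixes \<omega> :: "'n \<Rightarrow> 'a::field" and G :: "'j \<Rightarrow> 'n \<Rightarrow> 'a"
  assumes fin: "finite (UNIV :: 'n set)" and "finite A" and "\<And>c. \<omega> \<noteq> (\<lambda>i. \<Sum>j\<in>A. c j * G j i)"
  obtains \<Lambda> where "\<And>j. j \<in> A \<Longrightarrow> (\<Sum>i\<in>UNIV. \<Lambda> i * G j i) = 0" "(\<Sum>i\<in>UNIV. \<Lambda> i * \<omega> i) \<noteq> 0"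
proof -
  interpret vector_space_pair "\<lambda>(c :: 'a) (u :: 'n \<Rightarrow> 'a) i. c * u i" "(*) :: 'a \<Rightarrow> 'a \<Rightarrow> 'a"
    by unfold_locales (auto simp: algebra_simps fun_eq_iff)
  have \<omega>: "\<omega> \<notin> vs1.span (G ` A)"
  proof
    have "vs1.span (G ` A) \<subseteq> {\<lambda>i. \<Sum>j\<in>A. c j * G j i | c. True}"
    proof (rule vs1.span_minimal)
      show "G ` A \<subseteq> {\<lambda>i. \<Sum>j\<in>A. c j * G j i | c. True}"
      proof (clarify)
        fix j assume "j \<in> A"
        then show "\<exists>c. G j = (\<lambda>i. \<Sum>j\<in>A. c j * G j i) \<and> True"
          using assms(2)
          by (intro exI[of _ "\<lambda>l. if l = j then 1 else 0"]) (simp add: mult_delta_left)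
      qed
      show "vs1.subspace {\<lambda>i. \<Sum>j\<in>A. c j * G j i | c. True}"
      proof (rule vs1.subspaceI)
        show "0 \<in> {\<lambda>i. \<Sum>j\<in>A. c j * G j i | c. True}"
          by (intro CollectI exI[of _ "\<lambda>_. 0"]) (simp add: fun_eq_iff)
      next
        fix f g assume "f \<in> {\<lambda>i. \<Sum>j\<in>A. c j * G j i | c. True}" "g \<in> {\<lambda>i. \<Sum>j\<in>A. c j * G j i | c. True}"
        then obtain c d where "f = (\<lambda>i. \<Sum>j\<in>A. c j * G j i)" "g = (\<lambda>i. \<Sum>j\<in>A. d j * G j i)" by blast
        then show "f + g \<in> {\<lambda>i. \<Sum>j\<in>A. c j * G j i | c. True}"
          by (intro CollectI exI[of _ "\<lambda>j. c j + d j"]) (simp add: fun_eq_iff distrib_right sum.distrib)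
      next
        fix a f assume "f \<in> {\<lambda>i. \<Sum>j\<in>A. c j * G j i | c. True}"
        then obtain c where "f = (\<lambda>i. \<Sum>j\<in>A. c j * G j i)" by blast
        then have "(\<lambda>i. a * f i) = (\<lambda>i. \<Sum>j\<in>A. (a * c j) * G j i)"
          by (simp only: mult.assoc sum_distrib_left)
        then show "(\<lambda>i. a * f i) \<in> {\<lambda>i. \<Sum>j\<in>A. c j * G j i | c. True}"
          by (intro CollectI exI[of _ "\<lambda>j. a * c j"] conjI TrueI)
      qed
    qed
    moreover assume "\<omega> \<in> vs1.span (G ` A)"
    ultimately show False using assms(3) by blast
  qed
  \<comment> \<open>A basis \<open>B\<close> of the span stays independent when
    \<open>\<omega>\<close> is added, so there is a functional that is 1 at \<open>\<omega>\<close>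
    and 0 on \<open>B\<close>.\<close>
  obtain B where B: "B \<subseteq> G ` A" "vs1.independent B" "G ` A \<subseteq> vs1.span B"
    using vs1.maximal_independent_subset .
  have "\<omega> \<notin> vs1.span B"
    using \<omega> vs1.span_mono[OF B(1)] by blast
  then have "vs1.independent (insert \<omega> B)" "\<omega> \<notin> B"
    using B(2) vs1.independent_insertI vs1.span_base by blast+
  then obtain g where g: "Vector_Spaces.linear (\<lambda>c u i. c * u i) (*) g"
      "\<And>u. u \<in> insert \<omega> B \<Longrightarrow> g u = (if u = \<omega> then 1 else 0)"
    using linear_independent_extend[of "insert \<omega> B" "\<lambda>u. if u = \<omega> then 1 else 0"] by blast
  interpret g: Vector_Spaces.linear "\<lambda>c u i. c * u i" "(*)" g by (rule g(1))
  \<comment> \<open>The index type is finite, so the values on the unit vectors determine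
    \<open>g\<close>.\<close>
  define \<Lambda> where "\<Lambda> i = g (\<lambda>l. if l = i then 1 else 0)" for i
  have g_eq: "g u = (\<Sum>i\<in>UNIV. \<Lambda> i * u i)" for u
  proof -
    have sum_apply: "(\<Sum>i\<in>S. f i) l = (\<Sum>i\<in>S. f i l)" for S :: "'n set" and f :: "'n \<Rightarrow> 'n \<Rightarrow> 'a" and l
      by (induction S rule: infinite_finite_induct) simp_all
    have "u = (\<Sum>i\<in>UNIV. (\<lambda>l. u i * (if l = i then 1 else 0)))"
      using fin by (intro ext) (simp add: sum_apply mult_delta_right)
    then have "g u = g (\<Sum>i\<in>UNIV. (\<lambda>l. u i * (if l = i then 1 else 0)))"
      by (rule arg_cong)
    also have "\<dots> = (\<Sum>i\<in>UNIV. u i * \<Lambda> i)"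
      unfolding \<Lambda>_def g.sum by (rule sum.cong) (simp_all only: g.scale)
    finally have "g u = (\<Sum>i\<in>UNIV. u i * \<Lambda> i)" .
    then show ?thesis by (simp add: mult.commute)
  qed
  have "g u = 0" if "u \<in> vs1.span B" for u
    by (rule g.eq_0_on_span[OF _ that]) (use g(2) \<open>\<omega> \<notin> B\<close> in auto)
  then show ?thesis
    using that[of \<Lambda>] g_eq g(2)[of \<omega>] B(3) by (metis image_subset_iff insertI1 zero_neq_one)
qed

section \<open>Ideal powers, quotients, integrality, orders in t and cosets\<close>

lemma mem_ideal_power:
  assumes "x \<in> J" "1 \<in> S"
  shows "x ^ N \<in> J [^]\<^bsub>ideals_set (ring_of (S :: 'a::comm_ring_1 set))\<^esub> N"
proof (induction N)
  case 0
  show ?case using assms by (simp add: ideals_set_def nat_pow_def)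
next
  case (Suc N)
  from ideal_prod.prod[OF Suc assms(1), of "ring_of S"] show ?case
    by (simp add: ideals_set_def nat_pow_def mult.commute)
qed

lemma quotient_iso_projection:
  fixes \<iota> :: "'b::comm_ring_1 set \<Rightarrow> 'a::comm_ring_1" and R :: "'a set"
  assumes ideal: "ideal I (ring_of (UNIV :: 'b set))"
    and iso: "\<iota> \<in> ring_iso (ring_of UNIV Quot I) (ring_of R)"
    and \<phi>_def: "\<phi> = (\<lambda>f. \<iota> (I +>\<^bsub>ring_of UNIV\<^esub> f))"
  shows "range \<phi> = R" "\<phi> (f + g) = \<phi> f + \<phi> g" "\<phi> (f * g) = \<phi> f * \<phi> g" "\<phi> 1 = 1"
    "\<phi> f = 0 \<longleftrightarrow> f \<in> I"
proof -
  interpret P: cring "ring_of (UNIV :: 'b set)" by (rule cring_ring_of_UNIV)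
  interpret I: ideal I "ring_of UNIV" by (rule ideal)
  let ?q = "\<lambda>f. I +>\<^bsub>ring_of UNIV\<^esub> f"
  have q: "?q \<in> ring_hom (ring_of UNIV) (ring_of UNIV Quot I)" by (rule I.rcos_ring_hom)
  have \<iota>: "\<iota> \<in> ring_hom (ring_of UNIV Quot I) (ring_of R)"
    "bij_betw \<iota> (carrier (ring_of UNIV Quot I)) R"
    using iso by (simp_all add: ring_iso_def)
  have hom: "\<phi> \<in> ring_hom (ring_of UNIV) (ring_of R)"
    using ring_hom_trans[OF q \<iota>(1)] by (simp add: \<phi>_def comp_def)
  show add: "\<phi> (f + g) = \<phi> f + \<phi> g" for f g using ring_hom_add[OF hom, of f g] by simp
  show "\<phi> (f * g) = \<phi> f * \<phi> g" for f g using ring_hom_mult[OF hom, of f g] by simp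
  show "\<phi> 1 = 1" using ring_hom_one[OF hom] by simp
  have carr: "carrier (ring_of UNIV Quot I) = range ?q"
    by (auto simp: FactRing_def A_RCOSETS_def')
  show "range \<phi> = R"
    using \<iota>(2) unfolding carr bij_betw_def \<phi>_def by (auto simp: image_image)
  have "\<phi> 0 = 0" using add[of 0 0] by simp
  moreover have "?q 0 = I" using I.a_rcos_const[of 0] I.zero_closed by simp
  moreover have "\<phi> f = \<phi> 0 \<longleftrightarrow> ?q f = ?q 0"
    using \<iota>(2) unfolding carr bij_betw_def \<phi>_def by (auto dest: inj_onD)
  moreover have "?q f = I \<longleftrightarrow> f \<in> I"
    using I.a_rcos_const[of f] I.a_rcos_self[of f] by auto
  ultimately show "\<phi> f = 0 \<longleftrightarrow> f \<in> I" by simp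
qed

text \<open>Each \<open>r\<close> is a root of the monic polynomial X - r. This places
  \<open>R\<close> inside k[[t]], so that its elements have no poles.\<close>

lemma subset_integral_closure:
  fixes R :: "'a::field set"
  assumes R: "cring (ring_of R)"
  shows "R \<subseteq> integral_closure R"
proof
  fix r assume r: "r \<in> R"
  interpret cring "ring_of R" by (rule R)
  have R1: "1 \<in> R" and R0: "0 \<in> R" using one_closed zero_closed by simp_all
  have "- r \<in> R"
    using a_inv_closed[of r] r l_neg[of r] by (simp add: eq_neg_iff_add_eq_0[symmetric])
  then have "coeff [:- r, 1:] i \<in> R" for i
    using R1 R0 by (simp add: coeff_pCons split: nat.split)
  moreover have "r = r / 1" by simp
  then have "r \<in> frac_field R" unfolding frac_field_def using r R1 one_neq_zero by blast
  ultimately show "r \<in> integral_closure R"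
    unfolding integral_closure_def by (intro CollectI conjI exI[of _ "[:- r, 1:]"]) auto
qed

text \<open>The integrand has order at least a k + b - 1 in t, integration raises this to a k + b,
  and a k + b > a (k + 1). Inverting the unit factor of \<open>x\<close> turns t^(a (k + 1)) into a
  multiple of \<open>x ^ Suc k\<close>.\<close>

lemma fps_integral_factor:
  fixes x y :: "'k::field_char_0 fps"
  assumes "is_unit u" "a < b" "x = u * fps_X ^ a" "y = w * fps_X ^ b"
  shows "\<exists>q. fps_integral0 (x ^ k * fps_deriv y) = x ^ Suc k * q"
proof -
  have dvd_deriv: "fps_X ^ (b - 1) dvd fps_deriv y"
  proof -
    have "fps_deriv y = fps_deriv w * fps_X ^ b + w * fps_const (of_nat b) * fps_X ^ (b - 1)"
      by (simp add: assms(4) fps_deriv_power mult_ac)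
    also have "fps_X ^ b = fps_X * (fps_X ^ (b - 1) :: 'k fps)"
      using assms(2) by (cases b) simp_all
    also have "fps_deriv w * (fps_X * fps_X ^ (b - 1)) + w * fps_const (of_nat b) * fps_X ^ (b - 1)
        = fps_X ^ (b - 1) * (w * fps_const (of_nat b) + fps_X * fps_deriv w)"
      by (simp add: algebra_simps)
    finally have "fps_deriv y = fps_X ^ (b - 1) * (w * fps_const (of_nat b) + fps_X * fps_deriv w)" .
    then show ?thesis by simp
  qed
  obtain q where q: "x ^ k * fps_deriv y = fps_X ^ (a * k + (b - 1)) * q"
    using mult_dvd_mono[of "fps_X ^ (a * k)" "x ^ k" "fps_X ^ (b - 1)" "fps_deriv y"] dvd_deriv
    by (auto simp: assms(3) power_mult_distrib power_mult power_add dvd_def)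
  let ?z = "fps_integral0 (x ^ k * fps_deriv y)"
  have "fps_nth ?z i = 0" if "i < a * Suc k" for i
    using that assms(2) unfolding q by (cases i) (auto simp: fps_X_power_mult_nth)
  then have z: "?z = fps_X ^ (a * Suc k) * fps_shift (a * Suc k) ?z"
    by (intro fps_ext) (auto simp: fps_X_power_mult_nth)
  obtain u' where "u * u' = 1" using assms(1) by (auto simp: dvd_def)
  then have "x ^ Suc k * u' ^ Suc k = fps_X ^ (a * Suc k)"
    unfolding assms(3) power_mult_distrib[symmetric] power_mult
    by (metis mult.commute mult.left_commute mult.right_neutral)
  then have "?z = x ^ Suc k * (u' ^ Suc k * fps_shift (a * Suc k) ?z)"
    using z by (metis mult.assoc)
  then show ?thesis by blast
qed

text \<open>The scalar multiple of a coset is a union over all its representatives, so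
  \<open>r\<close> must carry each of them, not just \<open>\<omega>\<close>, into
  \<open>U\<close>.\<close>

lemma smult_quot_module_eq_zero:
  assumes "U \<noteq> {}"
    and add: "\<And>u w. u \<in> U \<Longrightarrow> w \<in> U \<Longrightarrow> (\<lambda>i. u i + w i) \<in> U"
    and diff: "\<And>u w. u \<in> U \<Longrightarrow> w \<in> U \<Longrightarrow> (\<lambda>i. u i - w i) \<in> U"
    and smult: "\<And>u. u \<in> U \<Longrightarrow> (\<lambda>i. r * u i) \<in> U"
    and "(\<lambda>i. r * \<omega> i) \<in> U"
  shows "r \<odot>\<^bsub>quot_module (free_module R) U\<^esub> (U +>\<^bsub>free_module R\<^esub> \<omega>)
    = \<zero>\<^bsub>quot_module (free_module R) U\<^esub>"
proof -
  have coset: "U +>\<^bsub>free_module R\<^esub> s = {\<lambda>i. h i + s i | h. h \<in> U}" for s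
    by (auto simp: a_r_coset_def' free_module_def)
  have absorb: "U +>\<^bsub>free_module R\<^esub> s = U" if "s \<in> U" for s
  proof
    show "U +>\<^bsub>free_module R\<^esub> s \<subseteq> U" using add that by (auto simp: coset)
    show "U \<subseteq> U +>\<^bsub>free_module R\<^esub> s"
      unfolding coset using diff[OF _ that] by (force intro: exI[of _ "\<lambda>i. _ i - s i"])
  qed
  have "(\<lambda>i. r * u i) \<in> U" if "u \<in> U +>\<^bsub>free_module R\<^esub> \<omega>" for u
    using that add[OF smult assms(5)] by (auto simp: coset distrib_left)
  then have "U +>\<^bsub>free_module R\<^esub> (\<lambda>i. r * u i) = U" if "u \<in> U +>\<^bsub>free_module R\<^esub> \<omega>" for u
    using that absorb by blast
  moreover have "U +>\<^bsub>free_module R\<^esub> \<omega> \<noteq> {}" using assms(1) by (auto simp: coset)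
  ultimately have "(\<Union>u\<in>U +>\<^bsub>free_module R\<^esub> \<omega>. U +>\<^bsub>free_module R\<^esub> (\<lambda>i. r * u i)) = U"
    by auto
  then show ?thesis by (simp add: quot_module_def free_module_def)
qed

text \<open>Realising \<open>R\<close> inside k((t)) turns the identification of its integral
  closure with k[[t]] into the equation \<open>closure\<close>. Through \<open>algebra\<close> the
  isomorphism respects constants, so that derivations built from partial derivatives vanish on
  them.\<close>

theorem theorem3:
  fixes n N p :: nat
    and v :: "nat \<Rightarrow> 'n"
    and I :: "('n, 'k::{alg_closed_field, field_char_0}) mfps set"
    and F :: "nat \<Rightarrow> ('n, 'k) mfps"
    and R :: "'k fls set"
    and \<iota> :: "('n, 'k) mfps set \<Rightarrow> 'k fls"
    and \<alpha> :: "nat \<Rightarrow> 'k fps"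
    and a :: "nat \<Rightarrow> nat"
  defines "P \<equiv> ring_of (UNIV :: ('n, 'k) mfps set)"
    and "\<phi> \<equiv> (\<lambda>f. \<iota> (I +>\<^bsub>ring_of UNIV\<^esub> f))"
  assumes n: "n \<ge> 2" and vars: "bij_betw v {1..n} UNIV"
    and ideal: "ideal I P"
    and generators: "I = genideal P (F ` {1..p})"
    and order: "I \<subseteq> genideal P (range mfps_X) [^]\<^bsub>ideals_set P\<^esub> (2::nat)"
    and dom: "domain (P Quot I)"
    and local: "local_ring (P Quot I)"
    and dim: "krull_dim (P Quot I) = 1"
    and iso: "\<iota> \<in> ring_iso (P Quot I) (ring_of R)"
    and algebra: "\<And>c. \<phi> (mfps_const c) = fls_const c"
    and closure: "integral_closure R = range fps_to_fls"
    and param: "\<And>i. i \<in> {1..n} \<Longrightarrow>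
      is_unit (\<alpha> i) \<and> \<phi> (mfps_X (v i)) = fps_to_fls (\<alpha> i * fps_X ^ a i)"
    and exponents: "strict_mono_on {1..n} a"
    and N: "N \<ge> 2"
    and cond: "genideal (ring_of R) ((\<lambda>i. \<phi> (mfps_X (v i))) ` {1..n})
      [^]\<^bsub>ideals_set (ring_of R)\<^esub> N \<subseteq> conductor R"
    and mono1: "mfps_X (v 1) ^ (N - 1) \<notin> monomial_support_ideal I"
    and mono2: "mfps_X (v 1) ^ (N - 2) * mfps_X (v 2) \<notin> monomial_support_ideal I"
  shows "torsion_submodule R (differentials R \<phi> F p) \<noteq> {\<zero>\<^bsub>differentials R \<phi> F p\<^esub>}"
proof -

  \<comment> \<open>The projection onto \<open>R\<close>\<close>
  note \<phi> = quotient_iso_projection[OF ideal[unfolded P_def] iso[unfolded P_def] \<phi>_def[THEN meta_eq_to_obj_eq]]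
  have \<phi>_mem: "\<phi> f \<in> R" for f using \<phi>(1) by blast
  have \<phi>_surj: "\<exists>f. r = \<phi> f" if "r \<in> R" for r using that \<phi>(1) by blast
  have \<phi>_0: "\<phi> 0 = 0" using \<phi>(2)[of 0 0] by simp
  have \<phi>_diff: "\<phi> (f - g) = \<phi> f - \<phi> g" for f g using \<phi>(2)[of "f - g" g] by simp
  have \<phi>_sum: "\<phi> (sum f A) = (\<Sum>j\<in>A. \<phi> (f j))" for f and A :: "nat set"
    by (induction A rule: infinite_finite_induct) (simp_all add: \<phi>(2) \<phi>_0)
  have \<phi>_power: "\<phi> (f ^ k) = \<phi> f ^ k" for f k
    by (induction k) (simp_all add: \<phi>(3,4))
  have R1: "1 \<in> R" using \<phi>_mem[of 1] by (simp add: \<phi>(4))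
  have R_add: "r + s \<in> R" and R_diff: "r - s \<in> R" and R_mult: "r * s \<in> R"
    if "r \<in> R" "s \<in> R" for r s
    using \<phi>_surj[OF that(1)] \<phi>_surj[OF that(2)] \<phi>_mem \<phi>(2,3) \<phi>_diff by metis+
  have cring_R: "cring (ring_of R)" by (rule cring_ring_of[OF R1 R_diff R_mult])
  have R_fps: "\<exists>w. r = fps_to_fls w" if "r \<in> R" for r
    using that subset_integral_closure[OF cring_R] closure by blast
  have fin: "finite (UNIV :: 'n set)" using bij_betw_finite[OF vars] by simp
  have v12: "v 1 \<noteq> v 2" using vars n by (auto simp: bij_betw_def dest: inj_onD)
  have I_eq: "I = {\<Sum>j=1..p. \<rho> j * F j | \<rho>. True}"
    using generators genideal_image_ring_of_UNIV[of "{1..p}" F] by (simp add: P_def)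
  have F0: "\<phi> (F j) = 0" if "j \<in> {1..p}" for j
  proof -
    have "F j \<in> I" unfolding generators genideal_def using that by blast
    then show ?thesis by (simp add: \<phi>(5))
  qed

  \<comment> \<open>The first two parameters and the conductor\<close>
  define x where "x = \<alpha> 1 * fps_X ^ a 1"
  define y where "y = \<alpha> 2 * fps_X ^ a 2"
  have \<alpha>: "is_unit (\<alpha> 1)" and x: "\<phi> (mfps_X (v 1)) = fps_to_fls x"
    and y: "\<phi> (mfps_X (v 2)) = fps_to_fls y"
    using param[of 1] param[of 2] n by (auto simp: x_def y_def)
  have a12: "a 1 < a 2" using strict_mono_onD[OF exponents, of 1 2] n by simp
  have x_nz: "x \<noteq> 0" using \<alpha> by (auto simp: x_def)
  \<comment> \<open>\<open>x ^ N\<close> comes from the N-th power of the maximal ideal, hence lies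
    in the conductor, which multiplies k[[t]] into \<open>R\<close>.\<close>
  have xN: "fps_to_fls (x ^ N * w) \<in> R" for w
  proof -
    have "\<phi> (mfps_X (v 1)) \<in> genideal (ring_of R) ((\<lambda>i. \<phi> (mfps_X (v i))) ` {1..n})"
      using n by (auto simp: genideal_def)
    from mem_ideal_power[OF this R1, of N] cond have "fps_to_fls x ^ N \<in> conductor R"
      unfolding x[symmetric] by blast
    then show ?thesis
      using closure by (auto simp: conductor_def fls_times_fps_to_fls fps_to_fls_power)
  qed

  define z where "z = fps_integral0 (x ^ (N - 1) * fps_deriv y)"
  have z_deriv: "fps_deriv z = x ^ (N - 1) * fps_deriv y"
    by (simp add: z_def fps_deriv_fps_integral)
  have "fps_to_fls z \<in> R"
    using fps_integral_factor[OF \<alpha> a12 x_def y_def, of "N - 1"] xN N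
    by (auto simp: z_def)
  then obtain Z where Z: "fps_to_fls z = \<phi> Z" using \<phi>_surj by blast

  \<comment> \<open>The coordinates of the form; dz is computed from a lift \<open>Z\<close> of
    \<open>z\<close>, and another lift would change \<open>\<omega>\<close> only by an element of
    the Jacobian image.\<close>
  define \<omega> where
    "\<omega> i = (if i = v 2 then \<phi> (mfps_X (v 1)) ^ (N - 1) else 0) - \<phi> (mfps_deriv i Z)" for i
  have \<omega>_R: "\<omega> i \<in> R" for i
    using R_diff[OF \<phi>_mem[of "mfps_X (v 1) ^ (N - 1)"] \<phi>_mem] R_diff[OF \<phi>_mem[of 0] \<phi>_mem]
    by (simp add: \<omega>_def \<phi>_power \<phi>_0)

  \<comment> \<open>The form is nonzero in the cokernel\<close>
  let ?U = "jacobian_map \<phi> F p ` ({1..p} \<rightarrow> R)"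
  have "\<omega> \<notin> ?U"
  proof
    assume "\<omega> \<in> ?U"
    then obtain r where r: "\<omega> = jacobian_map \<phi> F p r" "r \<in> {1..p} \<rightarrow> R" by blast
    have "\<forall>j\<in>{1..p}. \<exists>\<rho>. r j = \<phi> \<rho>" using r(2) \<phi>_surj by blast
    then obtain \<rho> where \<rho>: "\<And>j. j \<in> {1..p} \<Longrightarrow> r j = \<phi> (\<rho> j)" by metis
    \<comment> \<open>Since each \<open>F j\<close> vanishes in \<open>R\<close>, the Leibniz rule
      leaves only \<open>\<rho> j\<close> times the differential of \<open>F j\<close>. Thus the
      Jacobian combination is absorbed into an exact form.\<close>
    let ?h = "Z + (\<Sum>j=1..p. \<rho> j * F j)"
    have "\<phi> ((if i = v 2 then mfps_X (v 1) ^ (N - 1) else 0) - mfps_deriv i ?h) = 0" for i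
    proof -
      have "\<phi> (mfps_deriv i ?h) = \<phi> (mfps_deriv i Z) + (\<Sum>j=1..p. r j * \<phi> (mfps_deriv i (F j)))"
        by (simp add: mfps_deriv_add mfps_deriv_sum mfps_deriv_mult \<phi>(2,3) \<phi>_sum F0 \<rho>)
      then show ?thesis
        using fun_cong[OF r(1), of i]
        by (auto simp: \<omega>_def jacobian_map_def \<phi>_diff \<phi>_power \<phi>_0 diff_eq_eq split: if_splits)
          (simp_all add: algebra_simps neg_eq_iff_add_eq_0)
    qed
    from this[of "v 2"] this[of "v 1"] v12 power_dX_not_exact_mod_ideal[OF v12 N mono1 mono2, of ?h]
    show False by (simp add: \<phi>(5))
  qed

  \<comment> \<open>Linear dependence over k((t)) on the differentials of the generators\<close>
  have "\<exists>c. \<omega> = (\<lambda>i. \<Sum>j=1..p. c j * \<phi> (mfps_deriv i (F j)))"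
  proof (rule ccontr)
    assume "\<not> ?thesis"
    then obtain \<Lambda> where
      \<Lambda>: "\<And>j. j \<in> {1..p} \<Longrightarrow> (\<Sum>i\<in>UNIV. \<Lambda> i * \<phi> (mfps_deriv i (F j))) = 0"
        "(\<Sum>i\<in>UNIV. \<Lambda> i * \<omega> i) \<noteq> 0"
      using separating_linear_functional[OF fin, of "{1..p}" \<omega> "\<lambda>j i. \<phi> (mfps_deriv i (F j))"]
      by blast
    define D where "D f = (\<Sum>i\<in>UNIV. \<Lambda> i * \<phi> (mfps_deriv i f))" for f
    have D_add: "D (f + g) = D f + D g" for f g
      by (simp add: D_def mfps_deriv_add \<phi>(2) distrib_left sum.distrib)
    have D_mult: "D (f * g) = \<phi> f * D g + \<phi> g * D f" for f g
      by (simp add: D_def mfps_deriv_mult \<phi>(2,3) distrib_left sum.distrib sum_distrib_left mult_ac)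
    have D_const: "D (mfps_const c) = 0" for c
      by (simp add: D_def mfps_deriv_const \<phi>_0)
    have D_X: "D (mfps_X k) = \<Lambda> k" for k
    proof -
      have "mfps_deriv i (mfps_X k) = (if i = k then 1 else 0 :: ('n, 'k) mfps)" for i
        by (rule mfps_deriv_X)
      then have "D (mfps_X k) = (\<Sum>i\<in>UNIV. if i = k then \<Lambda> i else 0)"
        unfolding D_def by (intro sum.cong) (simp_all add: \<phi>(4) \<phi>_0)
      then show ?thesis using fin by simp
    qed
    have D_I: "D f = 0" if f: "f \<in> I" for f
    proof -
      obtain \<rho> where \<rho>: "f = (\<Sum>j=1..p. \<rho> j * F j)" using f I_eq by blast
      have "D (\<Sum>j\<in>A. \<rho> j * F j) = 0" if "A \<subseteq> {1..p}" for A
        using finite_subset[OF that finite_atLeastAtMost] that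
      proof (induction A rule: finite_induct)
        case empty
        show ?case using D_add[of 0 0] by simp
      next
        case (insert j A)
        then have "D (F j) = 0" using \<Lambda>(1) by (simp add: D_def)
        then show ?case using insert F0 by (simp add: D_add D_mult)
      qed
      then show ?thesis using \<rho> by simp
    qed
    have D_cong: "D f = D g" if "\<phi> f = \<phi> g" for f g
    proof -
      have "f - g \<in> I" using that by (simp add: \<phi>(5)[symmetric] \<phi>_diff)
      then show ?thesis using D_add[of "f - g" g] D_I by simp
    qed
    \<comment> \<open>By \<open>D_cong\<close> the chosen preimage does not matter: \<open>D\<close>
      kills \<open>I\<close> and descends to \<open>R\<close>.\<close>
    define \<delta> where "\<delta> r = D (SOME f. r = \<phi> f)" for r
    have \<delta>: "\<delta> (\<phi> f) = D f" for f
      unfolding \<delta>_def by (rule someI2[of _ f]) (auto intro: D_cong)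
    \<comment> \<open>The finitely many coordinates of \<open>\<Lambda>\<close> have a common pole
      bound, which carries over to all values of \<open>\<delta>\<close> because \<open>R\<close>
      lies in k[[t]].\<close>
    obtain B where B: "\<And>i. fls_X ^ B * \<Lambda> i \<in> range fps_to_fls"
      using finite_fls_common_denominator[of "range \<Lambda>"] fin by auto
    have "\<exists>c. \<forall>w. fps_to_fls w \<in> R \<longrightarrow> \<delta> (fps_to_fls w) = c * fps_to_fls (fps_deriv w)"
    proof (rule subring_derivation_eq[where x = "fps_to_fls (x ^ N)" and B = B])
      show "fls_const c \<in> R" for c using \<phi>_mem algebra by metis
      show "\<delta> (fls_const c) = 0" for c using \<delta>[of "mfps_const c"] by (simp add: algebra D_const)
      show "fps_to_fls (x ^ N) \<noteq> 0" using x_nz by simp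
      show "fps_to_fls (x ^ N) \<in> R" using xN[of 1] by simp
      show "fps_to_fls (x ^ N) * fps_to_fls w \<in> R" for w
        using xN[of w] by (simp add: fls_times_fps_to_fls)
      fix r s assume "r \<in> R" "s \<in> R"
      then obtain f g where rs: "r = \<phi> f" "s = \<phi> g" using \<phi>_surj by metis
      show "r * s \<in> R" using rs \<phi>_mem \<phi>(3) by metis
      show "\<delta> (r + s) = \<delta> r + \<delta> s" by (simp add: rs \<delta> D_add \<phi>(2)[symmetric])
      show "\<delta> (r * s) = r * \<delta> s + s * \<delta> r" by (simp add: rs \<delta> D_mult \<phi>(3)[symmetric])
    next
      fix r assume "r \<in> R"
      then obtain f where f: "r = \<phi> f" using \<phi>_surj by blast
      have "\<forall>i. \<exists>u. fls_X ^ B * \<Lambda> i = fps_to_fls u" using B by blast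
      then obtain u where u: "\<And>i. fls_X ^ B * \<Lambda> i = fps_to_fls (u i)" by metis
      have "\<forall>i. \<exists>w. \<phi> (mfps_deriv i f) = fps_to_fls w" using R_fps \<phi>_mem by blast
      then obtain w where w: "\<And>i. \<phi> (mfps_deriv i f) = fps_to_fls (w i)" by metis
      have "fls_X ^ B * \<delta> r = (\<Sum>i\<in>UNIV. fps_to_fls (u i * w i))"
        by (simp add: f \<delta> D_def sum_distrib_left mult.assoc[symmetric] u w fls_times_fps_to_fls)
      also have "\<dots> = fps_to_fls (\<Sum>i\<in>UNIV. u i * w i)"
        using fin by (induction rule: finite_induct) simp_all
      finally show "fls_X ^ B * \<delta> r \<in> range fps_to_fls" by simp
    qed
    then obtain c where c: "\<And>f w. \<phi> f = fps_to_fls w \<Longrightarrow> D f = c * fps_to_fls (fps_deriv w)"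
      using \<delta> \<phi>_mem by metis
    \<comment> \<open>With \<open>D\<close> equal to c d/dt, the value is c (x^(N-1) y' - z'), which
      is 0 by the choice of \<open>z\<close>.\<close>
    have "(\<Sum>i\<in>UNIV. \<Lambda> i * \<omega> i)
        = (\<Sum>i\<in>UNIV. if i = v 2 then \<Lambda> i * \<phi> (mfps_X (v 1)) ^ (N - 1) else 0) - D Z"
      unfolding D_def sum_subtractf[symmetric]
      by (rule sum.cong) (simp_all add: \<omega>_def algebra_simps)
    also have "\<dots> = D (mfps_X (v 2)) * fps_to_fls x ^ (N - 1) - D Z"
      using fin by (simp add: D_X x[symmetric])
    also have "\<dots> = 0"
      using c[OF y] c[OF Z[symmetric]]
      by (simp add: z_deriv fls_times_fps_to_fls fps_to_fls_power)
    finally show False using \<Lambda>(2) by simp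
  qed
  then obtain c where c: "\<omega> = (\<lambda>i. \<Sum>j=1..p. c j * \<phi> (mfps_deriv i (F j)))" by blast
  obtain B where B: "\<And>j. j \<in> {1..p} \<Longrightarrow> fls_X ^ B * c j \<in> range fps_to_fls"
    using finite_fls_common_denominator[OF finite_imageI[OF finite_atLeastAtMost], of c 1 p] by blast
  \<comment> \<open>The power of t clears the denominators of all \<open>c j\<close>; the factor
    \<open>x ^ N\<close> then moves the resulting power series into \<open>R\<close>.\<close>
  define r where "r = fps_to_fls (x ^ N * fps_X ^ B)"
  have r: "r \<in> R" "r \<noteq> 0" using xN x_nz by (simp_all add: r_def)
  have "r * c j \<in> R" if j: "j \<in> {1..p}" for j
  proof -
    obtain w where "fls_X ^ B * c j = fps_to_fls w" using B[OF j] by blast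
    then have "r * c j = fps_to_fls (x ^ N * w)"
      by (simp add: r_def fls_times_fps_to_fls fps_to_fls_power mult.assoc)
    then show ?thesis using xN by simp
  qed
  then have r\<omega>: "(\<lambda>i. r * \<omega> i) \<in> ?U"
    by (intro image_eqI[where x = "\<lambda>j. r * c j"])
      (auto simp: c jacobian_map_def sum_distrib_left mult.assoc)

  \<comment> \<open>Passage to cosets in the module of differentials\<close>
  have module: "module (ring_of R) (differentials R \<phi> F p)"
    using cring_R \<phi>(1) by (intro module_differentials) simp_all
  have zero_U: "(\<lambda>i. 0) \<in> ?U"
    by (rule image_eqI[where x = "\<lambda>_. 0"]) (use \<phi>_mem[of 0] \<phi>_0 in \<open>auto simp: jacobian_map_def\<close>)
  let ?w = "?U +>\<^bsub>free_module R\<^esub> \<omega>"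
  have w_carrier: "?w \<in> carrier (differentials R \<phi> F p)"
    using \<omega>_R by (auto simp: differentials_def quot_module_def A_RCOSETS_def' free_module_def)
  have r_w: "r \<odot>\<^bsub>differentials R \<phi> F p\<^esub> ?w = \<zero>\<^bsub>differentials R \<phi> F p\<^esub>"
    unfolding differentials_def
  proof (rule smult_quot_module_eq_zero)
    fix u w assume "u \<in> ?U" "w \<in> ?U"
    then obtain b d where b: "u = jacobian_map \<phi> F p b" "b \<in> {1..p} \<rightarrow> R"
      and d: "w = jacobian_map \<phi> F p d" "d \<in> {1..p} \<rightarrow> R" by blast
    show "(\<lambda>i. u i + w i) \<in> ?U"
      by (rule image_eqI[where x = "\<lambda>j. b j + d j"])
        (use b d R_add in \<open>auto simp: jacobian_map_def distrib_right sum.distrib\<close>)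
    show "(\<lambda>i. u i - w i) \<in> ?U"
      by (rule image_eqI[where x = "\<lambda>j. b j - d j"])
        (use b d R_diff in \<open>auto simp: jacobian_map_def left_diff_distrib sum_subtractf\<close>)
    show "(\<lambda>i. r * u i) \<in> ?U"
      by (rule image_eqI[where x = "\<lambda>j. r * b j"])
        (use b R_mult r(1) in \<open>auto simp: jacobian_map_def sum_distrib_left mult.assoc\<close>)
  next
    show "?U \<noteq> {}" using zero_U by (metis empty_iff)
    show "(\<lambda>i. r * \<omega> i) \<in> ?U" by (rule r\<omega>)
  qed
  have "?w \<in> torsion_submodule R (differentials R \<phi> F p)"
    by (rule torsion_submoduleI[OF cring_R module w_carrier r r_w])
  moreover have "?w \<noteq> \<zero>\<^bsub>differentials R \<phi> F p\<^esub>"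
  proof
    assume w: "?w = \<zero>\<^bsub>differentials R \<phi> F p\<^esub>"
    \<comment> \<open>The zero of the quotient is \<open>?U\<close> itself, so a vanishing coset
      would put its representative \<open>\<omega>\<close> into \<open>?U\<close>.\<close>
    have "\<omega> \<in> ?w"
      unfolding a_r_coset_def' by (rule UN_I[OF zero_U]) (simp add: free_module_def)
    with w have "\<omega> \<in> ?U" by (simp add: differentials_def quot_module_def)
    with \<open>\<omega> \<notin> ?U\<close> show False ..
  qed
  ultimately show ?thesis by blast
qed

end
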